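(* There is an absolute constant $C>0$ such that for every $\epsilon$ with $0<\epsilon<2$ there exist an integer $d\le 2^{C(\log_2\frac{4}{\epsilon})^2}$ and a PPT state $\rho'$ on $\mathbb{C}^d\otimes\mathbb{C}^d$ with \[ {\rm dist}(\rho',\mathcal{SEP})\ \ge\ 2-\epsilon . \] Moreover, one may take $\rho'=\rho^{\otimes l}$ with $l=\lceil\log_2\frac4\epsilon\rceil$, $d_s=\lceil(\frac{4l}{\epsilon}-1)^2\rceil$, $d=(2d_s)^l$, where $\rho$ is the following state on $\mathbb{C}^2_A\otimes\mathbb{C}^2_B\otimes\mathbb{C}^{d_s}_{A'}\otimes\mathbb{C}^{d_s}_{B'}$: fix a unitary $U=(u_{ij})$ of size $d_s$ with $|u_{ij}|=1/\sqrt{d_s}$ for all $i,j$, put \[ X=\frac{1}{d_s\sqrt{d_s}}\sum_{i,j=1}^{d_s}u_{ij}|ij\rangle\langle ji|,\quad Y=\frac1{d_s}\sum_{i,j=1}^{d_s}u_{ij}|ii\rangle\langle jj|,\quad p=\frac{1}{1+\sqrt{d_s}}, \] and let, in block form with respect to the basis $|00\rangle,|01\rangle,|10\rangle,|11\rangle$ of $AB$, \[ \rho=\frac12\begin{pmatrix} (1-p)\sqrt{XX^\dagger} & 0 & 0 & (1-p)X\\ 0 & p\sqrt{YY^\dagger} & pY & 0\\ 0 & pY^\dagger & p\sqrt{Y^\dagger Y} & 0\\ (1-p)X^\dagger & 0 & 0 & (1-p)\sqrt{X^\dagger X} \end{pmatrix}; \] the state $\rho^{\otimes l}$ is regarded as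 a bipartite state on $\mathbb{C}^d\otimes\mathbb{C}^d$ with $\mathbb{C}^d=(\mathbb{C}^2\otimes\mathbb{C}^{d_s})^{\otimes l}$ being the $(AA')^{\otimes l}$ part and the other factor the $(BB')^{\otimes l}$ part.
   Context: A state is a positive semidefinite operator of trace one. For a bipartite system $\mathbb{C}^d\otimes\mathbb{C}^d$, a state is PPT if its partial transpose $({\rm Id}\otimes T)(\rho)$ is positive semidefinite, and $\mathcal{SEP}$ is the set of separable states (convex combinations of product states). The trace norm is $\|Z\|_1={\rm Tr}\sqrt{ZZ^\dagger}$ and ${\rm dist}(\rho,\mathcal{SEP})=\min_{\sigma\in\mathcal{SEP}}\|\rho-\sigma\|_1$. Logarithms are base $2$. *)

theory Defs
  imports Complex_Main "Jordan_Normal_Form.Matrix"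
begin

definition cadj :: "complex mat \<Rightarrow> complex mat" where
  "cadj A = mat (dim_col A) (dim_row A) (\<lambda>(i,j). cnj (A $$ (j,i)))"

definition mtrace :: "complex mat \<Rightarrow> complex" where
  "mtrace A = (\<Sum>i<dim_row A. A $$ (i,i))"

definition psd :: "nat \<Rightarrow> complex mat \<Rightarrow> bool" where
  "psd n A \<longleftrightarrow> A \<in> carrier_mat n n \<and>
     (\<forall>v \<in> carrier_vec n. let q = conjugate v \<bullet> (A *\<^sub>v v) in Im q = 0 \<and> Re q \<ge> 0)"

definition is_state :: "nat \<Rightarrow> complex mat \<Rightarrow> bool" where
  "is_state n \<rho> \<longleftrightarrow> psd n \<rho> \<and> mtrace \<rho> = 1"

definition msqrt :: "complex mat \<Rightarrow> complex mat" where
  "msqrt A = (THE B. psd (dim_row A) B \<and> B * B = A)"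

definition trace_norm :: "complex mat \<Rightarrow> real" where
  "trace_norm Z = Re (mtrace (msqrt (Z * cadj Z)))"

text \<open>Kronecker (tensor) product; |a> (x) |b> has index a * dim_b + b.\<close>
definition kron :: "complex mat \<Rightarrow> complex mat \<Rightarrow> complex mat" where
  "kron A B = mat (dim_row A * dim_row B) (dim_col A * dim_col B)
     (\<lambda>(i,j). A $$ (i div dim_row B, j div dim_col B) * B $$ (i mod dim_row B, j mod dim_col B))"

text \<open>Partial transpose (Id (x) T) on C^d1 (x) C^d2:
  (Id (x) T)(|a b><a' b'|) = |a b'><a' b|.\<close>
definition ptrans :: "nat \<Rightarrow> nat \<Rightarrow> complex mat \<Rightarrow> complex mat" where
  "ptrans d1 d2 M = mat (d1*d2) (d1*d2)
     (\<lambda>(i,j). M $$ ((i div d2) * d2 + j mod d2, (j div d2) * d2 + i mod d2))"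

definition is_PPT :: "nat \<Rightarrow> nat \<Rightarrow> complex mat \<Rightarrow> bool" where
  "is_PPT d1 d2 \<rho> \<longleftrightarrow> is_state (d1*d2) \<rho> \<and> psd (d1*d2) (ptrans d1 d2 \<rho>)"

definition SEP_states :: "nat \<Rightarrow> nat \<Rightarrow> complex mat set" where
  "SEP_states d1 d2 = {mat (d1*d2) (d1*d2) (\<lambda>(i,j). \<Sum>(t::nat)<k. complex_of_real (w t) * kron (a t) (b t) $$ (i,j))
      | k w a b. (\<forall>t<k. w t \<ge> 0 \<and> is_state d1 (a t) \<and> is_state d2 (b t)) \<and> (\<Sum>t<k. w t) = 1}"

text \<open>dist(rho, SEP) = min over separable sigma of ||rho - sigma||_1 (the minimum is attained;
  we write it as an infimum).\<close>
definition dist_SEP :: "nat \<Rightarrow> nat \<Rightarrow> complex mat \<Rightarrow> real" where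
  "dist_SEP d1 d2 \<rho> = Inf {trace_norm (\<rho> - \<sigma>) | \<sigma>. \<sigma> \<in> SEP_states d1 d2}"

text \<open>Given a bipartite operator R on C^D (x) C^D, its l-fold tensor power R^{(x) l}, regarded as a
  bipartite operator on (C^D)^{(x) l} (x) (C^D)^{(x) l} (first factor = all first parts of the copies,
  second factor = all second parts).  An index of (C^D)^{(x) l} is written in base D, the k-th digit
  being the index in the k-th copy.\<close>
definition bip_tensor_pow :: "nat \<Rightarrow> nat \<Rightarrow> complex mat \<Rightarrow> complex mat" where
  "bip_tensor_pow D l R = mat (D^l * D^l) (D^l * D^l)
     (\<lambda>(i,j). \<Prod>k<l. R $$ (((i div D^l) div D^k mod D) * D + ((i mod D^l) div D^k mod D),
                            ((j div D^l) div D^k mod D) * D + ((j mod D^l) div D^k mod D)))"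

definition flat_unitary :: "nat \<Rightarrow> complex mat \<Rightarrow> bool" where
  "flat_unitary ds U \<longleftrightarrow> U \<in> carrier_mat ds ds \<and> U * cadj U = 1\<^sub>m ds \<and> cadj U * U = 1\<^sub>m ds \<and>
     (\<forall>i<ds. \<forall>j<ds. cmod (U $$ (i,j)) = 1 / sqrt ds)"

text \<open>Operators on A'B' = C^ds (x) C^ds (indices 0-based; |ij> has index i*ds+j).\<close>
definition Xop :: "nat \<Rightarrow> complex mat \<Rightarrow> complex mat" where
  "Xop ds U = mat (ds*ds) (ds*ds) (\<lambda>(r,s). \<Sum>i<ds. \<Sum>j<ds.
      if r = i*ds + j \<and> s = j*ds + i then U $$ (i,j) / complex_of_real (ds * sqrt ds) else 0)"

definition Yop :: "nat \<Rightarrow> complex mat \<Rightarrow> complex mat" where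
  "Yop ds U = mat (ds*ds) (ds*ds) (\<lambda>(r,s). \<Sum>i<ds. \<Sum>j<ds.
      if r = i*ds + i \<and> s = j*ds + j then U $$ (i,j) / of_nat ds else 0)"

text \<open>The blocks of rho with respect to the basis |00>,|01>,|10>,|11> (indices 0..3) of AB
  (including the overall factor 1/2).\<close>
definition rho_block :: "nat \<Rightarrow> complex mat \<Rightarrow> nat \<Rightarrow> nat \<Rightarrow> complex mat" where
  "rho_block ds U q q' = (let X = Xop ds U; Y = Yop ds U; p = 1 / (1 + sqrt ds); n = ds*ds;
      a = complex_of_real ((1 - p) / 2); b = complex_of_real (p / 2) in
     if q = 0 \<and> q' = 0 then a \<cdot>\<^sub>m msqrt (X * cadj X)
     else if q = 0 \<and> q' = 3 then a \<cdot>\<^sub>m X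
     else if q = 1 \<and> q' = 1 then b \<cdot>\<^sub>m msqrt (Y * cadj Y)
     else if q = 1 \<and> q' = 2 then b \<cdot>\<^sub>m Y
     else if q = 2 \<and> q' = 1 then b \<cdot>\<^sub>m cadj Y
     else if q = 2 \<and> q' = 2 then b \<cdot>\<^sub>m msqrt (cadj Y * Y)
     else if q = 3 \<and> q' = 0 then a \<cdot>\<^sub>m cadj X
     else if q = 3 \<and> q' = 3 then a \<cdot>\<^sub>m msqrt (cadj X * X)
     else 0\<^sub>m n n)"

text \<open>rho on A (x) B (x) A' (x) B' (dimension 4 ds^2), index (2a+b)*ds^2 + (x*ds+y).\<close>
definition rho_ABAB :: "nat \<Rightarrow> complex mat \<Rightarrow> complex mat" where
  "rho_ABAB ds U = mat (4*(ds*ds)) (4*(ds*ds)) (\<lambda>(i,j).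
     rho_block ds U (i div (ds*ds)) (j div (ds*ds)) $$ (i mod (ds*ds), j mod (ds*ds)))"

text \<open>Index of |a b x y> (A,B,A',B') from the index of |(a x)(b y)> in (AA') (x) (BB'),
  where AA' = C^2 (x) C^ds has index a*ds+x.\<close>
definition reorder_idx :: "nat \<Rightarrow> nat \<Rightarrow> nat" where
  "reorder_idx ds i = (let \<alpha> = i div (2*ds); \<beta> = i mod (2*ds);
       a = \<alpha> div ds; x = \<alpha> mod ds; b = \<beta> div ds; y = \<beta> mod ds
     in (2*a + b) * (ds*ds) + (x*ds + y))"

definition rho_bip :: "nat \<Rightarrow> complex mat \<Rightarrow> complex mat" where
  "rho_bip ds U = mat ((2*ds)*(2*ds)) ((2*ds)*(2*ds))
     (\<lambda>(i,j). rho_ABAB ds U $$ (reorder_idx ds i, reorder_idx ds j))"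

end

(* Up to normalisation rho is a sum of rank-one terms f f*, where f runs over the vectors
   |00 xy> + sqrt n cnj(u_xy) |11 yx> and (sum over x of u_xz |01 xx>) + |10 zz>, and its antidiagonal
   blocks are balanced by the choice of p so that the partial transpose leaves rho unchanged; hence
   rho and all its tensor powers are PPT.

   The vectors of the first kind, divided by sqrt 2, are orthonormal; let Q be the projection onto
   their span. Then Tr(Q rho) = 1 - p, so the l-th tensor power of Q has expectation (1 - p)^l in that
   of rho. Against a product state a (x) b only the moduli of the entries matter, and these are
   bounded by products of square roots of diagonal entries. Grouping the basis by the l key bits,
   Minkowski's inequality and AM-GM bound the expectation of the tensor power of Q by 2^(-l).
   For a Hermitian Z and a projection P one has ||Z||_1 >= 2 Tr(P Z) - Tr Z, so the distance is at
   least 2 ((1 - p)^l - 2^(-l)), and Bernoulli's inequality finishes. *)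

theory Submission
  imports Defs "Jordan_Normal_Form.Schur_Decomposition" "HOL-Analysis.L2_Norm"
begin

section \<open>Spectral theory of Hermitian matrices\<close>

text \<open>The obstacle is that a separable state of l copies may be entangled among the copies on
  either side. Its overlap with the tensor power of Q then does not factor, and a bound 1/2 for one
  copy does not by itself give 2^(-l); the estimate has to treat all copies at once, through
  diagonal entries only. The value of p comes from the partial transpose, which exchanges the
  entries (1 - p) u_xy / (n sqrt n) of X with the entries p u_xy / n of Y; they agree exactly when 1
  - p = p sqrt n. Since p tends to 0 as n grows, n can be taken so large that l p is at most
  epsilon/4, while l makes 2^(-l) at most epsilon/4; doubled, the two errors use up epsilon. Both l
  and log n are of order log (4/epsilon), hence the square in the exponent of d. The spectral
  theorem comes first because \<open>msqrt\<close> is a definite description: no trace norm can be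
  evaluated before positive square roots are known to be unique.\<close>

definition ip :: "nat \<Rightarrow> (nat \<Rightarrow> complex) \<Rightarrow> (nat \<Rightarrow> complex) \<Rightarrow> complex" where
  "ip n u v = (\<Sum>i<n. cnj (u i) * v i)"

definition qf :: "nat \<Rightarrow> complex mat \<Rightarrow> (nat \<Rightarrow> complex) \<Rightarrow> complex" where
  "qf n A v = (\<Sum>i<n. \<Sum>j<n. cnj (v i) * A $$ (i,j) * v j)"

definition orthonormal_fam :: "nat \<Rightarrow> 's set \<Rightarrow> ('s \<Rightarrow> nat \<Rightarrow> complex) \<Rightarrow> bool" where
  "orthonormal_fam n S F \<longleftrightarrow> finite S \<and> (\<forall>s\<in>S. \<forall>t\<in>S. ip n (F s) (F t) = (if s = t then 1 else 0))"

text \<open>Weighted sum of the rank-one operators |F s><F s|. No orthogonality is built in, so one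
  form serves for spectral decompositions, for the state and for its tensor powers.\<close>

definition gram :: "nat \<Rightarrow> 's set \<Rightarrow> ('s \<Rightarrow> real) \<Rightarrow> ('s \<Rightarrow> nat \<Rightarrow> complex) \<Rightarrow> complex mat" where
  "gram n S c F = mat n n (\<lambda>(i,j). \<Sum>s\<in>S. of_real (c s) * F s i * cnj (F s j))"

lemma gram_carrier [simp]: "gram n S c F \<in> carrier_mat n n"
  by (simp add: gram_def)

lemma dim_gram [simp]: "dim_row (gram n S c F) = n" "dim_col (gram n S c F) = n"
  by (simp_all add: gram_def)

lemma gram_index: "i < n \<Longrightarrow> j < n \<Longrightarrow>
    gram n S c F $$ (i,j) = (\<Sum>s\<in>S. of_real (c s) * F s i * cnj (F s j))"
  by (simp add: gram_def)

lemma ip_cnj: "cnj (ip n u v) = ip n v u"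
  by (simp add: ip_def mult.commute)

lemma ip_self: "ip n u u = of_real (\<Sum>i<n. (cmod (u i))\<^sup>2)"
  by (simp only: ip_def of_real_sum complex_norm_square mult.commute)

text \<open>Vectors are functions on all naturals; values from n on do not enter \<open>qf\<close>,
  so quantifying over all functions amounts to quantifying over
  \<open>carrier_vec n\<close>.\<close>

lemma psd_iff_qf:
  "psd n A \<longleftrightarrow> A \<in> carrier_mat n n \<and> (\<forall>v. Im (qf n A v) = 0 \<and> 0 \<le> Re (qf n A v))"
proof -
  have *: "conjugate v \<bullet> (A *\<^sub>v v) = qf n A (\<lambda>i. v $ i)"
    if "A \<in> carrier_mat n n" "v \<in> carrier_vec n" for v :: "complex vec"
    using that by (auto simp: scalar_prod_def qf_def sum_distrib_left mult.assoc atLeast0LessThan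
        intro!: sum.cong)
  have **: "qf n A v = qf n A (\<lambda>i. vec n v $ i)" for v
    unfolding qf_def by (intro sum.cong) auto
  show ?thesis
  proof
    assume p: "psd n A"
    then have A: "A \<in> carrier_mat n n" by (simp add: psd_def)
    have "Im (qf n A v) = 0 \<and> 0 \<le> Re (qf n A v)" for v
      using p[unfolded psd_def Let_def] *[OF A, of "vec n v"] **[of v] by (metis vec_carrier)
    with A show "A \<in> carrier_mat n n \<and> (\<forall>v. Im (qf n A v) = 0 \<and> 0 \<le> Re (qf n A v))" by blast
  next
    assume "A \<in> carrier_mat n n \<and> (\<forall>v. Im (qf n A v) = 0 \<and> 0 \<le> Re (qf n A v))"
    then show "psd n A" using * by (auto simp: psd_def Let_def)
  qed
qed

lemma qf_gram:
  "qf n (gram n S c F) v = of_real (\<Sum>s\<in>S. c s * (cmod (ip n (F s) v))\<^sup>2)"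
proof -
  have "qf n (gram n S c F) v =
      (\<Sum>i<n. \<Sum>j<n. \<Sum>s\<in>S. of_real (c s) * ((cnj (v i) * F s i) * (cnj (F s j) * v j)))"
    unfolding qf_def
    by (intro sum.cong refl) (simp add: gram_index sum_distrib_left sum_distrib_right mult_ac)
  also have "\<dots> = (\<Sum>i<n. \<Sum>s\<in>S. \<Sum>j<n. of_real (c s) * ((cnj (v i) * F s i) * (cnj (F s j) * v j)))"
    by (intro sum.cong refl sum.swap)
  also have "\<dots> = (\<Sum>s\<in>S. \<Sum>i<n. \<Sum>j<n. of_real (c s) * ((cnj (v i) * F s i) * (cnj (F s j) * v j)))"
    by (rule sum.swap)
  also have "\<dots> = (\<Sum>s\<in>S. of_real (c s) * (ip n v (F s) * ip n (F s) v))"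
    unfolding ip_def sum_product by (simp add: sum_distrib_left)
  also have "\<dots> = (\<Sum>s\<in>S. of_real (c s * (cmod (ip n (F s) v))\<^sup>2))"
    by (intro sum.cong refl) (simp only: of_real_mult complex_norm_square ip_cnj mult.commute)
  finally show ?thesis by simp
qed

lemma psd_gram:
  assumes "\<And>s. s \<in> S \<Longrightarrow> 0 \<le> c s"
  shows "psd n (gram n S c F)"
  using assms by (auto simp: psd_iff_qf qf_gram intro!: sum_nonneg)

lemma mtrace_gram: "mtrace (gram n S c F) = (\<Sum>s\<in>S. of_real (c s) * ip n (F s) (F s))"
proof -
  have "mtrace (gram n S c F) = (\<Sum>i<n. \<Sum>s\<in>S. of_real (c s) * F s i * cnj (F s i))"
    unfolding mtrace_def by (intro sum.cong) (auto simp: gram_index)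
  also have "\<dots> = (\<Sum>s\<in>S. \<Sum>i<n. of_real (c s) * F s i * cnj (F s i))"
    by (rule sum.swap)
  finally show ?thesis by (simp add: ip_def sum_distrib_left mult_ac)
qed

text \<open>Orthonormality kills the cross terms and the weights multiply pointwise; squares and
  square roots can thus be taken on the weights.\<close>

lemma gram_mult:
  assumes "orthonormal_fam n S F"
  shows "gram n S c F * gram n S d F = gram n S (\<lambda>s. c s * d s) F"
proof (rule eq_matI)
  fix i j assume "i < dim_row (gram n S (\<lambda>s. c s * d s) F)" "j < dim_col (gram n S (\<lambda>s. c s * d s) F)"
  then have ij: "i < n" "j < n" by auto
  have fin: "finite S" using assms by (simp add: orthonormal_fam_def)
  have "(gram n S c F * gram n S d F) $$ (i,j) =
      (\<Sum>k<n. gram n S c F $$ (i,k) * gram n S d F $$ (k,j))"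
    using ij by (simp add: scalar_prod_def atLeast0LessThan)
  also have "\<dots> = (\<Sum>k<n. \<Sum>s\<in>S. \<Sum>t\<in>S. (of_real (c s * d t) * F s i * cnj (F t j)) * (cnj (F s k) * F t k))"
    using ij by (intro sum.cong refl, simp add: gram_index sum_product, intro sum.cong refl)
      (simp add: mult_ac)
  also have "\<dots> = (\<Sum>s\<in>S. \<Sum>k<n. \<Sum>t\<in>S. (of_real (c s * d t) * F s i * cnj (F t j)) * (cnj (F s k) * F t k))"
    by (rule sum.swap)
  also have "\<dots> = (\<Sum>s\<in>S. \<Sum>t\<in>S. \<Sum>k<n. (of_real (c s * d t) * F s i * cnj (F t j)) * (cnj (F s k) * F t k))"
    by (intro sum.cong refl sum.swap)
  also have "\<dots> = (\<Sum>s\<in>S. \<Sum>t\<in>S. (of_real (c s * d t) * F s i * cnj (F t j)) * ip n (F s) (F t))"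
    by (simp add: ip_def sum_distrib_left)
  also have "\<dots> = (\<Sum>s\<in>S. \<Sum>t\<in>S. if s = t then of_real (c s * d t) * F s i * cnj (F t j) else 0)"
    using assms by (intro sum.cong refl) (auto simp: orthonormal_fam_def)
  also have "\<dots> = (\<Sum>s\<in>S. of_real (c s * d s) * F s i * cnj (F s j))"
    using fin by (simp add: sum.delta')
  finally show "(gram n S c F * gram n S d F) $$ (i,j) = gram n S (\<lambda>s. c s * d s) F $$ (i,j)"
    using ij by (simp add: gram_index)
qed auto

text \<open>The remainder w of v after projection is orthogonal to the family, so its squared norm
  is the difference of the two sides.\<close>

lemma bessel:
  assumes "orthonormal_fam n S F"
  shows "(\<Sum>s\<in>S. (cmod (ip n (F s) v))\<^sup>2) \<le> (\<Sum>i<n. (cmod (v i))\<^sup>2)"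
proof -
  define b where "b s = ip n (F s) v" for s
  define w where "w i = v i - (\<Sum>s\<in>S. b s * F s i)" for i
  have fin: "finite S" using assms by (simp add: orthonormal_fam_def)
  have lin: "ip n u w = ip n u v - (\<Sum>s\<in>S. b s * ip n u (F s))" for u
  proof -
    have "(\<Sum>i<n. \<Sum>s\<in>S. b s * (cnj (u i) * F s i)) = (\<Sum>s\<in>S. \<Sum>i<n. b s * (cnj (u i) * F s i))"
      by (rule sum.swap)
    then show ?thesis
      by (simp add: ip_def w_def right_diff_distrib sum_subtractf sum_distrib_left mult_ac)
  qed
  have z: "ip n (F t) w = 0" if "t \<in> S" for t
  proof -
    have "(\<Sum>s\<in>S. b s * ip n (F t) (F s)) = (\<Sum>s\<in>S. if t = s then b s else 0)"
      using assms that by (intro sum.cong refl) (auto simp: orthonormal_fam_def)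
    also have "\<dots> = b t" using that fin by simp
    finally show ?thesis by (simp add: lin b_def)
  qed
  have "ip n w (F s) = 0" if "s \<in> S" for s
    using z[OF that] ip_cnj[of n "F s" w] by simp
  then have "ip n w w = ip n w v" using lin[of w] by simp
  then have "ip n w w = ip n v w" using ip_cnj[of n w w] ip_cnj[of n w v] by simp
  also have "\<dots> = ip n v v - (\<Sum>s\<in>S. b s * ip n v (F s))" by (rule lin)
  also have "(\<Sum>s\<in>S. b s * ip n v (F s)) = of_real (\<Sum>s\<in>S. (cmod (b s))\<^sup>2)"
    unfolding of_real_sum by (intro sum.cong refl) (simp only: complex_norm_square b_def ip_cnj)
  finally have "of_real (\<Sum>i<n. (cmod (w i))\<^sup>2) =
      complex_of_real ((\<Sum>i<n. (cmod (v i))\<^sup>2) - (\<Sum>s\<in>S. (cmod (b s))\<^sup>2))"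
    unfolding ip_self of_real_diff .
  then have "(\<Sum>i<n. (cmod (w i))\<^sup>2) = (\<Sum>i<n. (cmod (v i))\<^sup>2) - (\<Sum>s\<in>S. (cmod (b s))\<^sup>2)"
    by (simp only: of_real_eq_iff)
  moreover have "0 \<le> (\<Sum>i<n. (cmod (w i))\<^sup>2)" by (simp add: sum_nonneg)
  ultimately show ?thesis by (simp add: b_def)
qed

text \<open>Each member has squared norm one. Exchanging the sums and applying Bessel's inequality
  to the n standard basis vectors bounds the total by n.\<close>

lemma card_orthonormal_fam_le:
  assumes "orthonormal_fam n S F"
  shows "card S \<le> n"
proof -
  define e :: "nat \<Rightarrow> nat \<Rightarrow> complex" where "e k = (\<lambda>i. if i = k then 1 else 0)" for k
  have ip_e: "ip n (F s) (e k) = cnj (F s k)" if "k < n" for s k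
    using that by (simp add: ip_def e_def if_distrib[of "\<lambda>x. _ * x"] cong: if_cong)
  have ne: "(\<Sum>i<n. (cmod (e k i))\<^sup>2) = 1" if "k < n" for k
  proof -
    have "(\<Sum>i<n. (cmod (e k i))\<^sup>2) = (\<Sum>i<n. if i = k then 1 else 0)"
      by (intro sum.cong) (auto simp: e_def)
    then show ?thesis using that by simp
  qed
  have "real (card S) = (\<Sum>s\<in>S. \<Sum>k<n. (cmod (F s k))\<^sup>2)"
  proof -
    have "(\<Sum>k<n. (cmod (F s k))\<^sup>2) = 1" if "s \<in> S" for s
      using assms that ip_self[of n "F s"] unfolding orthonormal_fam_def
      by (metis of_real_eq_1_iff)
    then show ?thesis by simp
  qed
  also have "\<dots> = (\<Sum>k<n. \<Sum>s\<in>S. (cmod (ip n (F s) (e k)))\<^sup>2)"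
    by (subst sum.swap) (intro sum.cong refl, simp add: ip_e)
  also have "\<dots> \<le> (\<Sum>k<n. 1)"
    using bessel[OF assms] ne by (intro sum_mono) (metis lessThan_iff)
  finally show ?thesis by simp
qed

section \<open>Eigenvalues and the spectral decomposition\<close>

definition herm :: "nat \<Rightarrow> complex mat \<Rightarrow> bool" where
  "herm n A \<longleftrightarrow> A \<in> carrier_mat n n \<and> (\<forall>i<n. \<forall>j<n. A $$ (i,j) = cnj (A $$ (j,i)))"

lemma mtrace_mult_comm:
  assumes "A \<in> carrier_mat n n" "B \<in> carrier_mat n n"
  shows "mtrace (A * B) = mtrace (B * A)"
proof -
  have *: "mtrace (A * B) = (\<Sum>i<n. \<Sum>j<n. A $$ (i,j) * B $$ (j,i))"
    if "A \<in> carrier_mat n n" "B \<in> carrier_mat n n" for A B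
    using that by (auto simp: mtrace_def scalar_prod_def atLeast0LessThan intro!: sum.cong)
  show ?thesis
    unfolding *[OF assms] *[OF assms(2,1)] by (subst sum.swap) (simp add: mult.commute)
qed

text \<open>The diagonal of a Schur form supplies the eigenvalue. Both the spectral theorem and the
  uniqueness of square roots draw their eigenvectors from here.\<close>

lemma herm_nonzero_eigenvalue:
  assumes A: "herm n A" and nz: "A \<noteq> 0\<^sub>m n n"
  obtains e where "eigenvalue A e" "e \<noteq> 0"
proof -
  have c: "A \<in> carrier_mat n n" using A by (simp add: herm_def)
  obtain es where es: "char_poly A = (\<Prod>a\<leftarrow>es. [:- a, 1:])"
    using char_poly_factorized[OF c] by blast
  define B where "B = schur_upper_triangular A es"
  note B = schur_upper_triangular[OF c es, folded B_def]
  obtain P Q where "similar_mat_wit A B P Q" using B(3) by (auto simp: similar_mat_def)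
  note w = similar_mat_witD2[OF c this]
  \<comment> \<open>otherwise the trace of A A, which is the squared Frobenius norm of A, vanishes\<close>
  have "\<exists>i<n. B $$ (i,i) \<noteq> 0"
  proof (rule ccontr)
    assume "\<not> ?thesis"
    then have z: "B $$ (i,j) = 0" if "j \<le> i" "i < n" for i j
      using that B(1,2) by (cases "j = i") (auto simp: upper_triangular_def)
    have BB: "B * B \<in> carrier_mat n n" using w by auto
    have "A * A = P * B * (Q * P) * B * Q"
      using w(4-7) unfolding w(3) by (simp add: assoc_mult_mat[of _ n n _ n _ n])
    also have "\<dots> = P * (B * B * Q)" using w(2,4-7) by (simp add: assoc_mult_mat[of _ n n _ n _ n])
    finally have "mtrace (A * A) = mtrace ((B * B * Q) * P)"
      using mtrace_mult_comm[of P n "B * B * Q"] w by simp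
    also have "(B * B * Q) * P = B * B"
      using w by (simp add: assoc_mult_mat[of _ n n _ n _ n])
    also have "mtrace (B * B) = (\<Sum>i<n. \<Sum>j<n. B $$ (i,j) * B $$ (j,i))"
      using B(1) by (auto simp: mtrace_def scalar_prod_def atLeast0LessThan intro!: sum.cong)
    \<comment> \<open>\<open>z\<close> covers the diagonal and everything below it; of the positions
      (i,j) and (j,i) at least one lies there.\<close>
    also have "\<dots> = 0"
      by (intro sum.neutral ballI) (metis lessThan_iff linear mult_eq_0_iff z)
    finally have tz: "mtrace (A * A) = 0" .
    have "mtrace (A * A) = (\<Sum>i<n. \<Sum>j<n. A $$ (i,j) * A $$ (j,i))"
      using c by (auto simp: mtrace_def scalar_prod_def atLeast0LessThan intro!: sum.cong)
    also have "\<dots> = (\<Sum>i<n. \<Sum>j<n. of_real ((cmod (A $$ (i,j)))\<^sup>2))"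
      using A unfolding herm_def complex_norm_square by (intro sum.cong refl) (metis lessThan_iff)
    also have "\<dots> = of_real (\<Sum>i<n. \<Sum>j<n. (cmod (A $$ (i,j)))\<^sup>2)" by simp
    finally have "(\<Sum>i<n. \<Sum>j<n. (cmod (A $$ (i,j)))\<^sup>2) = 0" using tz by (metis of_real_eq_0_iff)
    then have "A $$ (i,j) = 0" if "i < n" "j < n" for i j
      using that by (simp add: sum_nonneg_eq_0_iff sum_nonneg)
    then show False using nz c by (metis eq_matI carrier_matD index_zero_mat)
  qed
  then obtain i where i: "i < n" "B $$ (i,i) \<noteq> 0" by blast
  have "B $$ (i,i) \<in> set (diag_mat B)" using i B(1) by (auto simp: diag_mat_def)
  then have "poly (char_poly B) (B $$ (i,i)) = 0"
    unfolding char_poly_upper_triangular[OF B(1,2)] poly_prod_list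
    by (force simp: prod_list_zero_iff)
  then have "eigenvalue A (B $$ (i,i))"
    using eigenvalue_root_char_poly[OF c] char_poly_similar[OF B(3)] by simp
  with i that show thesis by blast
qed

definition mv :: "nat \<Rightarrow> complex mat \<Rightarrow> (nat \<Rightarrow> complex) \<Rightarrow> nat \<Rightarrow> complex" where
  "mv n A v = (\<lambda>i. \<Sum>j<n. A $$ (i,j) * v j)"

lemma qf_eq_ip_mv: "qf n A v = ip n v (mv n A v)"
  by (simp add: qf_def ip_def mv_def sum_distrib_left mult.assoc)

lemma herm_adjoint:
  assumes "herm n A"
  shows "ip n x (mv n A y) = ip n (mv n A x) y"
proof -
  have "ip n x (mv n A y) = (\<Sum>i<n. \<Sum>j<n. cnj (x i) * A $$ (i,j) * y j)"
    by (simp add: ip_def mv_def sum_distrib_left mult.assoc)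
  also have "\<dots> = (\<Sum>i<n. \<Sum>j<n. cnj (A $$ (j,i) * x i) * y j)"
    using assms unfolding herm_def
    by (intro sum.cong refl) (metis complex_cnj_mult lessThan_iff mult.commute)
  also have "\<dots> = (\<Sum>j<n. \<Sum>i<n. cnj (A $$ (j,i) * x i) * y j)" by (rule sum.swap)
  also have "\<dots> = ip n (mv n A x) y"
    by (simp add: ip_def mv_def sum_distrib_right)
  finally show ?thesis .
qed

lemma mv_mult:
  assumes "A \<in> carrier_mat n n" "B \<in> carrier_mat n n" "i < n"
  shows "mv n (A * B) v i = mv n A (mv n B v) i"
proof -
  have "mv n (A * B) v i = (\<Sum>j<n. \<Sum>k<n. A $$ (i,k) * (B $$ (k,j) * v j))"
    using assms unfolding mv_def
    by (intro sum.cong refl) (simp add: scalar_prod_def atLeast0LessThan sum_distrib_right mult.assoc)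
  also have "\<dots> = (\<Sum>k<n. \<Sum>j<n. A $$ (i,k) * (B $$ (k,j) * v j))" by (rule sum.swap)
  finally show ?thesis by (simp add: mv_def sum_distrib_left)
qed

lemma eigenvalue_unit_vector:
  assumes A: "A \<in> carrier_mat n n" and ev: "eigenvalue A e"
  obtains u where "ip n u u = 1" "\<And>i. i < n \<Longrightarrow> mv n A u i = e * u i"
proof -
  obtain w where w: "w \<in> carrier_vec n" "w \<noteq> 0\<^sub>v n" "A *\<^sub>v w = e \<cdot>\<^sub>v w"
    using ev A by (auto simp: eigenvalue_def eigenvector_def)
  define c where "c = sqrt (\<Sum>i<n. (cmod (w $ i))\<^sup>2)"
  have "\<exists>i<n. w $ i \<noteq> 0" using w(1,2) by auto
  then have "(\<Sum>i<n. (cmod (w $ i))\<^sup>2) > 0" by (force intro!: sum_pos2)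
  then have c: "c > 0" "c\<^sup>2 = (\<Sum>i<n. (cmod (w $ i))\<^sup>2)" by (simp_all add: c_def)
  define u where "u i = w $ i / of_real c" for i
  have "(\<Sum>i<n. (cmod (u i))\<^sup>2) = (\<Sum>i<n. (cmod (w $ i))\<^sup>2 / c\<^sup>2)"
    using c(1) by (intro sum.cong refl) (simp add: u_def norm_divide power_divide)
  also have "\<dots> = 1" unfolding sum_divide_distrib[symmetric] c(2)[symmetric] using c(1) by simp
  finally have 1: "ip n u u = 1" by (simp only: ip_self of_real_1)
  have "mv n A u i = e * u i" if i: "i < n" for i
  proof -
    have "(\<Sum>j<n. A $$ (i,j) * w $ j) = (A *\<^sub>v w) $ i"
      using i A w(1) by (simp add: scalar_prod_def atLeast0LessThan)
    also have "\<dots> = e * w $ i" using i w by simp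
    finally have "(\<Sum>j<n. A $$ (i,j) * w $ j) / of_real c = e * u i" by (simp add: u_def)
    then show ?thesis by (simp add: mv_def u_def sum_divide_distrib)
  qed
  with 1 that show thesis by blast
qed

lemma ip_scale_right:
  assumes "\<And>i. i < n \<Longrightarrow> w i = e * u i"
  shows "ip n x w = e * ip n x u"
  unfolding ip_def sum_distrib_left using assms by (intro sum.cong) auto

lemma herm_eigenvalue_real:
  assumes "herm n A" "ip n u u = 1" "\<And>i. i < n \<Longrightarrow> mv n A u i = e * u i"
  shows "cnj e = e"
proof -
  have "ip n u (mv n A u) = e" using ip_scale_right[OF assms(3), where x = u] assms(2) by simp
  moreover have "ip n (mv n A u) u = cnj (ip n u (mv n A u))" by (simp only: ip_cnj)
  ultimately show ?thesis using herm_adjoint[OF assms(1), of u u] by metis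
qed

text \<open>The induction ends because an orthonormal family has at most n members.\<close>

lemma spectral_deflation:
  fixes k :: nat
  assumes "herm n A'" "orthonormal_fam n {..<k} v"
    and "\<And>a i. a < k \<Longrightarrow> i < n \<Longrightarrow> mv n A' (v a) i = 0"
    and "A \<in> carrier_mat n n" "\<And>i j. i < n \<Longrightarrow> j < n \<Longrightarrow> A $$ (i,j) = gram n {..<k} lam v $$ (i,j) + A' $$ (i,j)"
  shows "\<exists>k lam v. orthonormal_fam n {..<k::nat} v \<and> A = gram n {..<k} lam v"
  using assms
proof (induction "n - k" arbitrary: k A' v lam rule: less_induct)
  case less
  have c: "A' \<in> carrier_mat n n" using less.prems(1) by (simp add: herm_def)
  show ?case
  proof (cases "A' = 0\<^sub>m n n")
    case True
    then have "A = gram n {..<k} lam v"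
      using less.prems(4,5) by (intro eq_matI) auto
    then show ?thesis using less.prems(2) by blast
  next
    case False
    obtain e where e: "eigenvalue A' e" "e \<noteq> 0"
      using herm_nonzero_eigenvalue[OF less.prems(1) False] by blast
    obtain u where u: "ip n u u = 1" "\<And>i. i < n \<Longrightarrow> mv n A' u i = e * u i"
      using eigenvalue_unit_vector[OF c e(1)] by blast
    have re: "cnj e = e" by (rule herm_eigenvalue_real[OF less.prems(1) u])
    then have re': "of_real (Re e) = e" by (simp add: complex_eq_iff)
    \<comment> \<open>Self-adjointness moves \<open>A'\<close> onto \<open>v a\<close>, which it
      annihilates; as e is not zero, the new eigenvector is orthogonal to all earlier ones.\<close>
    have orth: "ip n (v a) u = 0" "ip n u (v a) = 0" if "a < k" for a
    proof -
      have "e * ip n (v a) u = ip n (v a) (mv n A' u)"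
        using ip_scale_right[OF u(2), where x = "v a"] by simp
      also have "\<dots> = ip n (mv n A' (v a)) u" by (rule herm_adjoint[OF less.prems(1)])
      also have "\<dots> = 0" using less.prems(3)[OF that] by (simp add: ip_def)
      finally show "ip n (v a) u = 0" using e(2) by simp
      then show "ip n u (v a) = 0" using ip_cnj[of n "v a" u] by simp
    qed
    define v' where "v' = v(k := u)"
    define lam' where "lam' = lam(k := Re e)"
    define A2 where "A2 = mat n n (\<lambda>(i,j). A' $$ (i,j) - e * u i * cnj (u j))"
    have on: "orthonormal_fam n {..<Suc k} v'"
      using less.prems(2) u(1) orth by (auto simp: orthonormal_fam_def v'_def less_Suc_eq)
    have "Suc k \<le> n" using card_orthonormal_fam_le[OF on] by simp
    then have dec: "n - Suc k < n - k" by simp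
    have h: "herm n A2"
      unfolding herm_def
    proof (intro conjI allI impI)
      fix i j assume ij: "i < n" "j < n"
      then have "A' $$ (i,j) = cnj (A' $$ (j,i))"
        using less.prems(1) unfolding herm_def by blast
      then show "A2 $$ (i,j) = cnj (A2 $$ (j,i))" using re ij by (simp add: A2_def)
    qed (simp add: A2_def)
    \<comment> \<open>The invariant survives the subtraction: earlier vectors are orthogonal to u,
      and u itself goes to e u - e u = 0.\<close>
    have kill: "mv n A2 (v' a) i = 0" if "a < Suc k" "i < n" for a i
    proof -
      have *: "mv n A2 x i = mv n A' x i - e * u i * ip n u x" for x
        using \<open>i < n\<close> by (simp add: mv_def A2_def ip_def left_diff_distrib sum_subtractf
            sum_distrib_left mult.assoc)
      show ?thesis
        using that less.prems(3) u orth by (auto simp: * v'_def less_Suc_eq)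
    qed
    have split: "A $$ (i,j) = gram n {..<Suc k} lam' v' $$ (i,j) + A2 $$ (i,j)" if "i < n" "j < n" for i j
      using less.prems(5)[OF that] that re' by (simp add: gram_index A2_def lam'_def v'_def)
    show ?thesis
      by (rule less.hyps[OF dec h on kill less.prems(4) split])
  qed
qed

text \<open>Deflation starts from the empty family with \<open>A\<close> as remainder. It collects
  nonzero eigenvalues only, so k may be smaller than n; the kernel contributes nothing to traces and
  quadratic forms.\<close>

theorem herm_spectral:
  assumes "herm n A"
  obtains k lam v where "orthonormal_fam n {..<k::nat} v" "A = gram n {..<k} lam v"
proof -
  have "\<exists>k lam v. orthonormal_fam n {..<k::nat} v \<and> A = gram n {..<k} lam v"
  proof (rule spectral_deflation[OF assms, of 0 "\<lambda>_ _. 0" A "\<lambda>_. 0"])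
    show "A \<in> carrier_mat n n" using assms unfolding herm_def by blast
  qed (simp_all add: orthonormal_fam_def gram_index)
  with that show thesis by blast
qed

section \<open>Positive square roots and the trace norm\<close>

lemma qf_two_points:
  assumes "i < n" "j < n" "i \<noteq> j"
  shows "qf n A (\<lambda>k. (if k = i then y else 0) + (if k = j then z else 0)) =
    cnj y * A $$ (i,i) * y + cnj y * A $$ (i,j) * z + cnj z * A $$ (j,i) * y + cnj z * A $$ (j,j) * z"
proof -
  define v :: "nat \<Rightarrow> complex" where "v k = (if k = i then y else 0) + (if k = j then z else 0)" for k
  have s: "(\<Sum>k<n. g k) = g i + g j" if "\<And>k. k < n \<Longrightarrow> k \<noteq> i \<Longrightarrow> k \<noteq> j \<Longrightarrow> g k = 0" for g :: "nat \<Rightarrow> complex"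
  proof -
    have "(\<Sum>k<n. g k) = (\<Sum>k\<in>{i,j}. g k)"
      using assms that by (intro sum.mono_neutral_right) auto
    then show ?thesis using assms by simp
  qed
  have v: "v i = y" "v j = z" "\<And>k. k \<noteq> i \<Longrightarrow> k \<noteq> j \<Longrightarrow> v k = 0" using assms by (auto simp: v_def)
  have "qf n A v = (\<Sum>a<n. cnj (v a) * A $$ (a,i) * y + cnj (v a) * A $$ (a,j) * z)"
    unfolding qf_def by (intro sum.cong refl) (subst s, auto simp: v)
  also have "\<dots> = cnj y * A $$ (i,i) * y + cnj y * A $$ (i,j) * z + (cnj z * A $$ (j,i) * y + cnj z * A $$ (j,j) * z)"
    by (subst s) (auto simp: v)
  finally show ?thesis unfolding v_def[abs_def] by simp
qed

text \<open>The definition of \<open>psd\<close> asks only for a real nonnegative quadratic form;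
  hermiticity has to be recovered from it by polarisation.\<close>

lemma psd_imp_herm:
  assumes "psd n A"
  shows "herm n A"
proof -
  have q: "Im (qf n A v) = 0" for v using assms by (simp add: psd_iff_qf)
  have d: "Im (A $$ (i,i)) = 0" if "i < n" for i
  proof -
    have "qf n A (\<lambda>k. if k = i then 1 else 0) = A $$ (i,i)"
      using that by (simp add: qf_def if_distrib[of "\<lambda>x. _ * x"] if_distrib[of "\<lambda>x. x * _"] if_distrib[of cnj] cong: if_cong)
    then show ?thesis using q by metis
  qed
  have "A $$ (i,j) = cnj (A $$ (j,i))" if ij: "i < n" "j < n" for i j
  proof (cases "i = j")
    case True
    then show ?thesis using d ij by (simp add: complex_eq_iff)
  next
    case False
    \<comment> \<open>The vector e_i + e_j makes the imaginary parts of A_ij and A_ji opposite; e_i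
      + i e_j makes their real parts equal.\<close>
    from q[of "\<lambda>k. (if k = i then 1 else 0) + (if k = j then 1 else 0)"]
      q[of "\<lambda>k. (if k = i then 1 else 0) + (if k = j then \<i> else 0)"]
    show ?thesis unfolding qf_two_points[OF ij False] using d ij
      by (simp add: complex_eq_iff)
  qed
  then show ?thesis using assms unfolding herm_def psd_def by blast
qed

text \<open>A unit eigenvector u of D = B - C for an eigenvalue e satisfies
  0 = |Bu|^2 - |Cu|^2 = e (2 <u,Cu> + e), so <u,Bu> = - <u,Cu> unless e = 0.\<close>

lemma psd_sqrt_unique:
  assumes B: "psd n B" and C: "psd n C" and eq: "B * B = C * C"
  shows "B = C"
proof (rule ccontr)
  assume ne: "B \<noteq> C"
  have cB: "B \<in> carrier_mat n n" and cC: "C \<in> carrier_mat n n" using B C by (auto simp: psd_def)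
  define D where "D = mat n n (\<lambda>(i,j). B $$ (i,j) - C $$ (i,j))"
  have hB: "herm n B" and hC: "herm n C" using psd_imp_herm B C by blast+
  have hD: "herm n D"
    unfolding herm_def D_def
  proof (intro conjI allI impI)
    fix i j assume ij: "i < n" "j < n"
    then have "B $$ (i,j) = cnj (B $$ (j,i))" "C $$ (i,j) = cnj (C $$ (j,i))"
      using hB hC unfolding herm_def by blast+
    then show "mat n n (\<lambda>(i,j). B $$ (i,j) - C $$ (i,j)) $$ (i,j) =
        cnj (mat n n (\<lambda>(i,j). B $$ (i,j) - C $$ (i,j)) $$ (j,i))"
      using ij by simp
  qed simp
  have cD: "D \<in> carrier_mat n n" by (simp add: D_def)
  have "D \<noteq> 0\<^sub>m n n"
  proof
    assume "D = 0\<^sub>m n n"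
    then have "D $$ (i,j) = 0" if "i < n" "j < n" for i j using that by simp
    then have "B = C" using cB cC by (intro eq_matI) (auto simp: D_def)
    then show False using ne by simp
  qed
  then obtain e where e: "eigenvalue D e" "e \<noteq> 0"
    using herm_nonzero_eigenvalue[OF hD] by blast
  obtain u where u: "ip n u u = 1" "\<And>i. i < n \<Longrightarrow> mv n D u i = e * u i"
    using eigenvalue_unit_vector[OF cD e(1)] by blast
  have re: "cnj e = e" by (rule herm_eigenvalue_real[OF hD u])
  have Bu: "mv n B u i = mv n C u i + e * u i" if "i < n" for i
  proof -
    have "mv n D u i = mv n B u i - mv n C u i"
      using that by (simp add: mv_def D_def left_diff_distrib sum_subtractf)
    then show ?thesis using u(2)[OF that] by simp
  qed
  have right: "ip n x (mv n B u) = ip n x (mv n C u) + e * ip n x u" for x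
    unfolding ip_def sum_distrib_left sum.distrib[symmetric]
    by (intro sum.cong refl) (simp add: Bu algebra_simps)
  have left: "ip n (mv n B u) x = ip n (mv n C u) x + e * ip n u x" for x
    using arg_cong[OF right[of x], of cnj] re by (simp add: ip_cnj)
  have sq: "ip n (mv n M u) (mv n M u) = ip n u (mv n (M * M) u)" if "herm n M" for M
  proof -
    have "M \<in> carrier_mat n n" using that by (simp add: herm_def)
    then have "ip n u (mv n (M * M) u) = ip n u (mv n M (mv n M u))"
      unfolding ip_def by (intro sum.cong refl) (simp add: mv_mult)
    then show ?thesis using herm_adjoint[OF that, of u "mv n M u"] by simp
  qed
  have "ip n (mv n B u) (mv n B u) = ip n (mv n C u) (mv n C u)"
    using sq[OF hB] sq[OF hC] eq by simp
  moreover have "ip n (mv n B u) (mv n B u) =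
      ip n (mv n C u) (mv n C u) + e * (2 * qf n C u + e)"
    using herm_adjoint[OF hC, of u u] by (simp add: right left u(1) qf_eq_ip_mv algebra_simps)
  ultimately have e2: "e = - 2 * qf n C u" using e(2) by (auto simp: add_eq_0_iff)
  have "qf n B u = qf n C u + e" using right[of u] u(1) by (simp add: qf_eq_ip_mv)
  then have "qf n B u = - qf n C u" using e2 by simp
  \<comment> \<open>The two forms are nonnegative and opposite, hence zero, and then e = - 2
    \<open>qf n C u\<close> vanishes as well.\<close>
  moreover have "0 \<le> Re (qf n B u)" "0 \<le> Re (qf n C u)" using B C by (simp_all add: psd_iff_qf)
  ultimately have "Re (qf n C u) = 0" by simp
  moreover have "Im (qf n C u) = 0" using C by (simp add: psd_iff_qf)
  ultimately show False using e2 e(2) by (simp add: complex_eq_iff)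
qed

text \<open>Uniqueness turns any positive semidefinite root that can be exhibited into the value of
  the definite description.\<close>

lemma msqrt_eqI:
  assumes "psd n B" "A = B * B"
  shows "msqrt A = B"
proof -
  have "dim_row A = n" using assms by (auto simp: psd_def)
  then show ?thesis unfolding msqrt_def
    using assms psd_sqrt_unique by (intro the_equality) auto
qed

text \<open>Real weights make the matrix self-adjoint, so its product with its adjoint has weights
  c^2, and the positive root of that has weights |c|.\<close>

lemma trace_norm_gram:
  assumes "orthonormal_fam n S F"
  shows "trace_norm (gram n S c F) = (\<Sum>s\<in>S. \<bar>c s\<bar>)"
proof -
  have "cadj (gram n S c F) = gram n S c F"
    by (intro eq_matI) (auto simp: cadj_def gram_index mult_ac)
  then have "gram n S c F * cadj (gram n S c F) = gram n S (\<lambda>s. \<bar>c s\<bar>) F * gram n S (\<lambda>s. \<bar>c s\<bar>) F"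
    by (simp add: gram_mult[OF assms])
  then have "msqrt (gram n S c F * cadj (gram n S c F)) = gram n S (\<lambda>s. \<bar>c s\<bar>) F"
    by (intro msqrt_eqI[of n] psd_gram) auto
  then show ?thesis using assms by (simp add: trace_norm_def mtrace_gram orthonormal_fam_def)
qed

text \<open>The right side is the trace of (2P - 1) Z, where P projects onto the span of
  \<open>G\<close>. In an eigenbasis of Z each eigenvalue \<open>lam s\<close> gets the factor
  \<open>2 * b s - 1\<close>, and b s = <F s, P F s> lies between 0 and 1 by Bessel's
  inequality.\<close>

theorem trace_norm_ge:
  assumes Z: "herm n Z" and G: "orthonormal_fam n T G"
  shows "trace_norm Z \<ge> 2 * (\<Sum>t\<in>T. Re (qf n Z (G t))) - Re (mtrace Z)"
proof -
  obtain k lam F where F: "orthonormal_fam n {..<k::nat} F" and Zg: "Z = gram n {..<k} lam F"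
    using herm_spectral[OF Z] by blast
  define b where "b s = (\<Sum>t\<in>T. (cmod (ip n (F s) (G t)))\<^sup>2)" for s
  have b0: "0 \<le> b s" for s by (simp add: b_def sum_nonneg)
  have b1: "b s \<le> 1" if "s < k" for s
  proof -
    have "b s = (\<Sum>t\<in>T. (cmod (ip n (G t) (F s)))\<^sup>2)"
      unfolding b_def by (intro sum.cong refl) (metis complex_mod_cnj ip_cnj)
    also have "\<dots> \<le> (\<Sum>i<n. (cmod (F s i))\<^sup>2)" by (rule bessel[OF G])
    also have "\<dots> = 1"
      using F that ip_self[of n "F s"] unfolding orthonormal_fam_def by (metis lessThan_iff of_real_eq_1_iff)
    finally show ?thesis .
  qed
  have "(\<Sum>t\<in>T. Re (qf n Z (G t))) = (\<Sum>t\<in>T. \<Sum>s<k. lam s * (cmod (ip n (F s) (G t)))\<^sup>2)"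
    by (simp only: Zg qf_gram Re_complex_of_real)
  also have "\<dots> = (\<Sum>s<k. lam s * b s)"
    unfolding b_def sum_distrib_left by (rule sum.swap)
  finally have q: "(\<Sum>t\<in>T. Re (qf n Z (G t))) = (\<Sum>s<k. lam s * b s)" .
  have tr: "Re (mtrace Z) = (\<Sum>s<k. lam s)"
    using F by (simp add: Zg mtrace_gram orthonormal_fam_def)
  have "2 * (\<Sum>s<k. lam s * b s) - (\<Sum>s<k. lam s) = (\<Sum>s<k. lam s * (2 * b s - 1))"
    by (simp add: sum_subtractf sum_distrib_left algebra_simps)
  also have "\<dots> \<le> (\<Sum>s<k. \<bar>lam s\<bar>)"
  proof (intro sum_mono)
    fix s assume "s \<in> {..<k}"
    then have "\<bar>2 * b s - 1\<bar> \<le> 1" using b0[of s] b1[of s] by auto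
    then have "\<bar>lam s\<bar> * \<bar>2 * b s - 1\<bar> \<le> \<bar>lam s\<bar>" by (simp add: mult_left_le)
    then show "lam s * (2 * b s - 1) \<le> \<bar>lam s\<bar>" by (metis abs_ge_self abs_mult order_trans)
  qed
  also have "\<dots> = trace_norm Z" by (simp add: Zg trace_norm_gram[OF F])
  finally show ?thesis by (simp add: q tr)
qed

text \<open>Cauchy-Schwarz over the spectral decomposition: up to conjugation an entry is the inner
  product of two vectors with components \<open>sqrt (lam s) * F s i\<close>, whose squared norms
  are diagonal entries.\<close>

lemma psd_entry_bound:
  assumes "psd n A" "i < n" "j < n"
  shows "0 \<le> Re (A $$ (i,i))" "cmod (A $$ (i,j)) \<le> sqrt (Re (A $$ (i,i))) * sqrt (Re (A $$ (j,j)))"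
proof -
  obtain k lam F where F: "orthonormal_fam n {..<k::nat} F" and Ag: "A = gram n {..<k} lam F"
    using herm_spectral[OF psd_imp_herm[OF assms(1)]] by blast
  \<comment> \<open>Evaluating the form at the eigenvector \<open>F s\<close> isolates
    \<open>lam s\<close>.\<close>
  have lam: "0 \<le> lam s" if "s < k" for s
  proof -
    have "Re (qf n A (F s)) = (\<Sum>t<k. lam t * (cmod (ip n (F t) (F s)))\<^sup>2)"
      by (simp only: Ag qf_gram Re_complex_of_real)
    also have "\<dots> = (\<Sum>t<k. if t = s then lam t else 0)"
      using F that by (intro sum.cong refl) (auto simp: orthonormal_fam_def)
    also have "\<dots> = lam s" using that by simp
    finally show ?thesis using assms(1) by (metis psd_iff_qf)
  qed
  have diag: "Re (A $$ (m,m)) = (\<Sum>s<k. (sqrt (lam s) * cmod (F s m))\<^sup>2)" if "m < n" for m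
  proof -
    have "of_real ((sqrt (lam s) * cmod (F s m))\<^sup>2) = of_real (lam s) * F s m * cnj (F s m)" if "s < k" for s
    proof -
      have "(sqrt (lam s) * cmod (F s m))\<^sup>2 = lam s * (cmod (F s m))\<^sup>2"
        using lam[OF that] by (simp add: power_mult_distrib)
      then show ?thesis by (simp only: of_real_mult complex_norm_square mult.assoc)
    qed
    then have "A $$ (m,m) = (\<Sum>s<k. of_real ((sqrt (lam s) * cmod (F s m))\<^sup>2))"
      unfolding Ag gram_index[OF that that] by (intro sum.cong refl) simp
    then show ?thesis by simp
  qed
  show "0 \<le> Re (A $$ (i,i))" unfolding diag[OF assms(2)] by (intro sum_nonneg) auto
  have "cmod (A $$ (i,j)) \<le> (\<Sum>s<k. cmod (of_real (lam s) * F s i * cnj (F s j)))"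
    unfolding Ag gram_index[OF assms(2,3)] by (rule norm_sum)
  also have "\<dots> = (\<Sum>s<k. \<bar>sqrt (lam s) * cmod (F s i)\<bar> * \<bar>sqrt (lam s) * cmod (F s j)\<bar>)"
    using lam by (intro sum.cong refl) (simp add: norm_mult abs_mult)
  also have "\<dots> \<le> L2_set (\<lambda>s. sqrt (lam s) * cmod (F s i)) {..<k} * L2_set (\<lambda>s. sqrt (lam s) * cmod (F s j)) {..<k}"
    by (rule L2_set_mult_ineq)
  finally show "cmod (A $$ (i,j)) \<le> sqrt (Re (A $$ (i,i))) * sqrt (Re (A $$ (j,j)))"
    unfolding L2_set_def diag[OF assms(2)] diag[OF assms(3)] .
qed

section \<open>Tensor powers\<close>

text \<open>The index, in C^D (x) C^D, of the k-th copy within the index i of the regrouped tensor power.\<close>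

definition dig :: "nat \<Rightarrow> nat \<Rightarrow> nat \<Rightarrow> nat \<Rightarrow> nat" where
  "dig D l i k = ((i div D^l) div D^k mod D) * D + ((i mod D^l) div D^k mod D)"

lemma pair_index_less: "x < a \<Longrightarrow> y < b \<Longrightarrow> x * b + y < a * (b::nat)"
proof -
  assume "x < a" "y < b"
  then have "x * b + y < Suc x * b" by simp
  also have "\<dots> \<le> a * b" using \<open>x < a\<close> by (intro mult_le_mono1) simp
  finally show ?thesis .
qed

lemma digits_inject:
  fixes D :: nat
  assumes "i < D ^ l" "j < D ^ l" "\<And>k. k < l \<Longrightarrow> i div D^k mod D = j div D^k mod D"
  shows "i = j"
  using assms
proof (induction l arbitrary: i j)
  case 0
  then show ?case by simp
next
  case (Suc l)
  have "i div D = j div D"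
  proof (rule Suc.IH)
    show "i div D < D ^ l" "j div D < D ^ l"
      using Suc.prems(1,2) by (auto intro!: less_mult_imp_div_less simp: mult.commute)
    show "i div D div D ^ k mod D = j div D div D ^ k mod D" if "k < l" for k
      using Suc.prems(3)[of "Suc k"] that by (simp add: div_mult2_eq)
  qed
  moreover have "i mod D = j mod D" using Suc.prems(3)[of 0] by simp
  ultimately show ?case by (metis div_mult_mod_eq)
qed

lemma dig_less: "0 < D \<Longrightarrow> dig D l i k < D * D"
  unfolding dig_def by (rule pair_index_less) auto

lemma dig_div: "0 < D \<Longrightarrow> dig D l i k div D = (i div D^l) div D^k mod D"
  by (simp add: dig_def)

lemma dig_mod: "dig D l i k mod D = (i mod D^l) div D^k mod D"
  by (simp add: dig_def)

lemma dig_inject: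
  assumes "0 < D" "i < D^l * D^l" "j < D^l * D^l" "\<And>k. k < l \<Longrightarrow> dig D l i k = dig D l j k"
  shows "i = j"
proof -
  have "i div D^l = j div D^l"
  proof (rule digits_inject)
    show "i div D^l < D^l" "j div D^l < D^l" using assms(2,3) by (auto intro: less_mult_imp_div_less)
    show "i div D^l div D^k mod D = j div D^l div D^k mod D" if "k < l" for k
      using assms(4)[OF that] dig_div[OF assms(1)] by metis
  qed
  moreover have "i mod D^l = j mod D^l"
  proof (rule digits_inject)
    show "i mod D^l < D^l" "j mod D^l < D^l" using assms(1) by auto
    show "(i mod D^l) div D^k mod D = (j mod D^l) div D^k mod D" if "k < l" for k
      using assms(4)[OF that] dig_mod by metis
  qed
  ultimately show ?thesis by (metis div_mult_mod_eq)
qed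

text \<open>Surjectivity comes from counting: both sides have (D * D)^l elements.\<close>

lemma bij_betw_dig:
  assumes "0 < D"
  shows "bij_betw (\<lambda>i. restrict (dig D l i) {..<l}) {..<D^l * D^l} ({..<l} \<rightarrow>\<^sub>E {..<D*D})"
proof -
  let ?f = "\<lambda>i. restrict (dig D l i) {..<l}"
  have inj: "inj_on ?f {..<D^l * D^l}"
  proof (rule inj_onI)
    fix i j assume ij: "i \<in> {..<D^l * D^l}" "j \<in> {..<D^l * D^l}" "?f i = ?f j"
    have "dig D l i k = dig D l j k" if "k < l" for k
      using fun_cong[OF ij(3), of k] that by simp
    then show "i = j" using ij(1,2) by (intro dig_inject[OF assms, of i l j]) simp_all
  qed
  have sub: "?f ` {..<D^l * D^l} \<subseteq> ({..<l} \<rightarrow>\<^sub>E {..<D*D})"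
    using dig_less[OF assms] by (auto split: if_splits)
  have "card (?f ` {..<D^l * D^l}) = card ({..<l} \<rightarrow>\<^sub>E {..<D*D})"
    using inj by (simp add: card_image card_PiE power_mult_distrib)
  then have "?f ` {..<D^l * D^l} = ({..<l} \<rightarrow>\<^sub>E {..<D*D})"
    using sub by (intro card_subset_eq finite_PiE) auto
  with inj show ?thesis by (simp add: bij_betw_def)
qed

text \<open>Inner products, traces and quadratic forms of tensor powers all factor copy by copy
  through this distributive law.\<close>

lemma sum_prod_dig:
  fixes g :: "nat \<Rightarrow> nat \<Rightarrow> complex"
  assumes "0 < D"
  shows "(\<Sum>i<D^l * D^l. \<Prod>k<l. g k (dig D l i k)) = (\<Prod>k<l. \<Sum>m<D*D. g k m)"
proof -
  have "(\<Sum>i<D^l * D^l. \<Prod>k<l. g k (dig D l i k)) =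
      (\<Sum>i<D^l * D^l. \<Prod>k<l. g k (restrict (dig D l i) {..<l} k))"
    by (intro sum.cong prod.cong refl) simp
  also have "\<dots> = (\<Sum>f\<in>{..<l} \<rightarrow>\<^sub>E {..<D*D}. \<Prod>k<l. g k (f k))"
    by (rule sum.reindex_bij_betw[OF bij_betw_dig[OF assms]])
  also have "\<dots> = (\<Prod>k<l. \<Sum>m<D*D. g k m)"
    by (rule prod_sum_PiE[symmetric]) auto
  finally show ?thesis .
qed

lemma sum_sum_prod_dig:
  fixes g :: "nat \<Rightarrow> nat \<Rightarrow> nat \<Rightarrow> complex"
  assumes "0 < D"
  shows "(\<Sum>i<D^l * D^l. \<Sum>j<D^l * D^l. \<Prod>k<l. g k (dig D l i k) (dig D l j k)) =
    (\<Prod>k<l. \<Sum>m<D*D. \<Sum>m'<D*D. g k m m')"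
proof -
  have "(\<Sum>i<D^l * D^l. \<Sum>j<D^l * D^l. \<Prod>k<l. g k (dig D l i k) (dig D l j k)) =
      (\<Sum>i<D^l * D^l. \<Prod>k<l. \<Sum>m'<D*D. g k (dig D l i k) m')"
    by (intro sum.cong refl sum_prod_dig[OF assms, where g = "\<lambda>k. g k (dig D l i k)" for i])
  also have "\<dots> = (\<Prod>k<l. \<Sum>m<D*D. \<Sum>m'<D*D. g k m m')"
    by (rule sum_prod_dig[OF assms, where g = "\<lambda>k m. \<Sum>m'<D*D. g k m m'"])
  finally show ?thesis .
qed

text \<open>The tensor product of the vectors \<open>g (\<sigma> k)\<close>, in the regrouped
  coordinates where all first parts precede all second parts.\<close>

definition tens :: "nat \<Rightarrow> nat \<Rightarrow> ('s \<Rightarrow> nat \<Rightarrow> complex) \<Rightarrow> (nat \<Rightarrow> 's) \<Rightarrow> nat \<Rightarrow> complex" where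
  "tens D l g \<sigma> i = (\<Prod>k<l. g (\<sigma> k) (dig D l i k))"

lemma bip_tensor_pow_index:
  assumes "i < D^l * D^l" "j < D^l * D^l"
  shows "bip_tensor_pow D l R $$ (i,j) = (\<Prod>k<l. R $$ (dig D l i k, dig D l j k))"
  using assms by (simp add: bip_tensor_pow_def dig_def)

lemma ip_tens:
  assumes "0 < D"
  shows "ip (D^l * D^l) (tens D l g \<sigma>) (tens D l h \<tau>) = (\<Prod>k<l. ip (D*D) (g (\<sigma> k)) (h (\<tau> k)))"
  unfolding ip_def tens_def cnj_prod prod.distrib[symmetric]
  by (rule sum_prod_dig[OF assms, where g = "\<lambda>k m. cnj (g (\<sigma> k) m) * h (\<tau> k) m"])

lemma orthonormal_fam_tens:
  assumes "0 < D" "orthonormal_fam (D*D) S g"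
  shows "orthonormal_fam (D^l * D^l) ({..<l} \<rightarrow>\<^sub>E S) (tens D l g)"
  unfolding orthonormal_fam_def
proof (intro conjI ballI)
  show "finite ({..<l} \<rightarrow>\<^sub>E S)" using assms(2) by (auto simp: orthonormal_fam_def intro: finite_PiE)
  fix \<sigma> \<tau> assume st: "\<sigma> \<in> {..<l} \<rightarrow>\<^sub>E S" "\<tau> \<in> {..<l} \<rightarrow>\<^sub>E S"
  have "(\<Prod>k<l. ip (D*D) (g (\<sigma> k)) (g (\<tau> k))) = (\<Prod>k<l. if \<sigma> k = \<tau> k then 1 else 0)"
    using st assms(2) unfolding orthonormal_fam_def by (intro prod.cong refl) (auto simp: PiE_iff)
  \<comment> \<open>Members of the extensional function space agree outside \<open>{..<l}\<close>,
    so agreement on the l copies is equality.\<close>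
  also have "\<dots> = (if \<sigma> = \<tau> then 1 else 0)"
    using PiE_ext[OF st] by auto
  finally show "ip (D^l * D^l) (tens D l g \<sigma>) (tens D l g \<tau>) = (if \<sigma> = \<tau> then 1 else 0)"
    using ip_tens[OF assms(1), of l g \<sigma> g \<tau>] by simp
qed

text \<open>Expanding the product of sums yields rank-one terms again, with product weights;
  positivity of the tensor power is then immediate for nonnegative weights.\<close>

lemma bip_tensor_pow_gram:
  assumes "0 < D" "finite S"
  shows "bip_tensor_pow D l (gram (D*D) S c g) =
    gram (D^l * D^l) ({..<l} \<rightarrow>\<^sub>E S) (\<lambda>\<sigma>. \<Prod>k<l. c (\<sigma> k)) (tens D l g)"
proof (rule eq_matI)
  let ?N = "D^l * D^l"
  fix i j assume "i < dim_row (gram ?N ({..<l} \<rightarrow>\<^sub>E S) (\<lambda>\<sigma>. \<Prod>k<l. c (\<sigma> k)) (tens D l g))"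
    "j < dim_col (gram ?N ({..<l} \<rightarrow>\<^sub>E S) (\<lambda>\<sigma>. \<Prod>k<l. c (\<sigma> k)) (tens D l g))"
  then have ij: "i < ?N" "j < ?N" by auto
  have "bip_tensor_pow D l (gram (D*D) S c g) $$ (i,j) =
      (\<Prod>k<l. \<Sum>s\<in>S. of_real (c s) * g s (dig D l i k) * cnj (g s (dig D l j k)))"
    unfolding bip_tensor_pow_index[OF ij] by (intro prod.cong refl gram_index dig_less assms)
  also have "\<dots> = (\<Sum>\<sigma>\<in>{..<l} \<rightarrow>\<^sub>E S. \<Prod>k<l. of_real (c (\<sigma> k)) * g (\<sigma> k) (dig D l i k) * cnj (g (\<sigma> k) (dig D l j k)))"
    using assms(2) by (intro prod_sum_PiE) auto
  finally show "bip_tensor_pow D l (gram (D*D) S c g) $$ (i,j) =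
      gram ?N ({..<l} \<rightarrow>\<^sub>E S) (\<lambda>\<sigma>. \<Prod>k<l. c (\<sigma> k)) (tens D l g) $$ (i,j)"
    by (simp add: gram_index[OF ij] tens_def prod.distrib)
qed (simp_all add: bip_tensor_pow_def)

lemma mtrace_bip_tensor_pow:
  assumes "0 < D" "R \<in> carrier_mat (D*D) (D*D)"
  shows "mtrace (bip_tensor_pow D l R) = mtrace R ^ l"
proof -
  have "mtrace (bip_tensor_pow D l R) = (\<Sum>i<D^l * D^l. \<Prod>k<l. R $$ (dig D l i k, dig D l i k))"
    unfolding mtrace_def by (intro sum.cong) (auto simp: bip_tensor_pow_index bip_tensor_pow_def[of D l R] dig_def)
  also have "\<dots> = (\<Prod>k<l. \<Sum>m<D*D. R $$ (m,m))"
    by (rule sum_prod_dig[OF assms(1), where g = "\<lambda>k m. R $$ (m,m)"])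
  finally show ?thesis using assms(2) by (simp add: mtrace_def)
qed

lemma qf_bip_tensor_pow:
  assumes "0 < D"
  shows "qf (D^l * D^l) (bip_tensor_pow D l R) (tens D l g \<sigma>) = (\<Prod>k<l. qf (D*D) R (g (\<sigma> k)))"
proof -
  have "qf (D^l * D^l) (bip_tensor_pow D l R) (tens D l g \<sigma>) =
      (\<Sum>i<D^l * D^l. \<Sum>j<D^l * D^l. \<Prod>k<l. cnj (g (\<sigma> k) (dig D l i k)) *
         R $$ (dig D l i k, dig D l j k) * g (\<sigma> k) (dig D l j k))"
    unfolding qf_def by (intro sum.cong refl) (simp add: bip_tensor_pow_index tens_def prod.distrib)
  also have "\<dots> = (\<Prod>k<l. qf (D*D) R (g (\<sigma> k)))"
    unfolding qf_def
    by (rule sum_sum_prod_dig[OF assms, where g = "\<lambda>k m m'. cnj (g (\<sigma> k) m) * R $$ (m,m') * g (\<sigma> k) m'"])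
  finally show ?thesis .
qed

text \<open>When \<open>g\<close> is orthonormal and P projects onto its span, this says that the
  l-th tensor power of P has expectation Tr(P R)^l in that of R.\<close>

lemma sum_qf_bip_tensor_pow:
  assumes "0 < D" "finite S"
  shows "(\<Sum>\<sigma>\<in>{..<l} \<rightarrow>\<^sub>E S. qf (D^l * D^l) (bip_tensor_pow D l R) (tens D l g \<sigma>)) =
    (\<Sum>s\<in>S. qf (D*D) R (g s)) ^ l"
proof -
  have "(\<Sum>\<sigma>\<in>{..<l} \<rightarrow>\<^sub>E S. \<Prod>k<l. qf (D*D) R (g (\<sigma> k))) = (\<Prod>k<l. \<Sum>s\<in>S. qf (D*D) R (g s))"
    using assms(2) by (intro prod_sum_PiE[symmetric]) auto
  then show ?thesis by (simp add: qf_bip_tensor_pow[OF assms(1)])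
qed

text \<open>\<open>dig\<close> keeps the first and second part of each copy apart, and
  \<open>ptrans\<close> exchanges second parts only; the exchange therefore takes place in every
  copy on its own.\<close>

lemma ptrans_bip_tensor_pow:
  assumes D: "0 < D"
  shows "ptrans (D^l) (D^l) (bip_tensor_pow D l R) = bip_tensor_pow D l (ptrans D D R)"
proof (rule eq_matI)
  let ?N = "D^l"
  have N: "0 < ?N" using D by simp
  fix i j assume "i < dim_row (bip_tensor_pow D l (ptrans D D R))" "j < dim_col (bip_tensor_pow D l (ptrans D D R))"
  then have ij: "i < ?N * ?N" "j < ?N * ?N" by (simp_all add: bip_tensor_pow_def)
  have lt: "x div ?N * ?N + y mod ?N < ?N * ?N" if "x < ?N * ?N" for x y
    using that N by (intro pair_index_less) (auto intro: less_mult_imp_div_less)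
  have dg: "dig D l (x div ?N * ?N + y mod ?N) k = (dig D l x k div D) * D + dig D l y k mod D" for x y k
    unfolding dig_div[OF D] dig_mod using N by (simp add: dig_def)
  have "ptrans ?N ?N (bip_tensor_pow D l R) $$ (i,j) =
      bip_tensor_pow D l R $$ (i div ?N * ?N + j mod ?N, j div ?N * ?N + i mod ?N)"
    using ij by (simp add: ptrans_def)
  also have "\<dots> = (\<Prod>k<l. R $$ ((dig D l i k div D) * D + dig D l j k mod D, (dig D l j k div D) * D + dig D l i k mod D))"
    by (simp only: bip_tensor_pow_index lt ij dg)
  also have "\<dots> = (\<Prod>k<l. ptrans D D R $$ (dig D l i k, dig D l j k))"
    using dig_less[OF D] by (intro prod.cong refl) (simp add: ptrans_def)
  finally show "ptrans ?N ?N (bip_tensor_pow D l R) $$ (i,j) = bip_tensor_pow D l (ptrans D D R) $$ (i,j)"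
    by (simp only: bip_tensor_pow_index ij)
qed (simp_all add: bip_tensor_pow_def ptrans_def)

section \<open>Overlap with separable states\<close>

lemma L2_set_sum_le: "L2_set (\<lambda>i. \<Sum>m\<in>M. f m i) S \<le> (\<Sum>m\<in>M. L2_set (f m) S)"
proof (induction M rule: infinite_finite_induct)
  case (insert m M)
  have "L2_set (\<lambda>i. \<Sum>m\<in>insert m M. f m i) S = L2_set (\<lambda>i. f m i + (\<Sum>m\<in>M. f m i)) S"
    using insert.hyps by simp
  also have "\<dots> \<le> L2_set (f m) S + L2_set (\<lambda>i. \<Sum>m\<in>M. f m i) S"
    by (rule L2_set_triangle_ineq)
  also have "\<dots> \<le> (\<Sum>m\<in>insert m M. L2_set (f m) S)"
    using insert by simp
  finally show ?case .
qed (simp_all add: L2_set_def)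

lemma sum_div_mod:
  fixes h :: "nat \<Rightarrow> nat \<Rightarrow> 'a::comm_monoid_add"
  assumes "0 < b"
  shows "(\<Sum>i<a*b. h (i div b) (i mod b)) = (\<Sum>x<a. \<Sum>y<b. h x y)"
proof -
  have group: "(\<Sum>i<a*b. h (i div b) (i mod b)) = (\<Sum>m<a. sum (\<lambda>i. h (i div b) (i mod b)) {m*b..<m*b+b})"
    by (rule sum.nat_group[symmetric])
  have "sum (\<lambda>i. h (i div b) (i mod b)) {m*b..<m*b+b} = (\<Sum>y<b. h m y)" for m
    using sum.shift_bounds_nat_ivl[of "\<lambda>i. h (i div b) (i mod b)" 0 "m*b" b]
    by (simp add: add.commute atLeast0LessThan)
  then show ?thesis using group by simp
qed

text \<open>Injectivity leaves at most one index in each fibre, so squaring commutes with the inner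
  sum. Indices whose \<open>K\<close> value lies outside \<open>S\<close> are lost, whence only an
  inequality.\<close>

lemma sum_square_fibres:
  fixes \<gamma> :: "'i \<Rightarrow> real"
  assumes "finite S" "finite J" and inj: "inj_on K J"
  shows "(\<Sum>\<sigma>\<in>S. (\<Sum>i\<in>{i\<in>J. K i = \<sigma>}. \<gamma> i)\<^sup>2) \<le> (\<Sum>i\<in>J. (\<gamma> i)\<^sup>2)"
proof -
  have "(\<Sum>i\<in>{i\<in>J. K i = \<sigma>}. \<gamma> i)\<^sup>2 = (\<Sum>i\<in>J. if K i = \<sigma> then (\<gamma> i)\<^sup>2 else 0)" for \<sigma>
  proof (cases "\<exists>j\<in>J. K j = \<sigma>")
    case True
    then obtain j where j: "j \<in> J" "K j = \<sigma>" by blast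
    then have *: "{i\<in>J. K i = \<sigma>} = {j}" using inj by (auto dest: inj_onD)
    have "(\<Sum>i\<in>J. if K i = \<sigma> then (\<gamma> i)\<^sup>2 else 0) = (\<Sum>i\<in>{i\<in>J. K i = \<sigma>}. (\<gamma> i)\<^sup>2)"
      using assms(2) by (simp add: sum.inter_filter)
    then show ?thesis by (simp add: *)
  next
    case False
    then have *: "{i\<in>J. K i = \<sigma>} = {}" by blast
    show ?thesis using False unfolding * by (auto intro!: sum.neutral[symmetric])
  qed
  then have "(\<Sum>\<sigma>\<in>S. (\<Sum>i\<in>{i\<in>J. K i = \<sigma>}. \<gamma> i)\<^sup>2) = (\<Sum>i\<in>J. \<Sum>\<sigma>\<in>S. if K i = \<sigma> then (\<gamma> i)\<^sup>2 else 0)"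
    using sum.swap[of "\<lambda>\<sigma> i. if K i = \<sigma> then (\<gamma> i)\<^sup>2 else 0" J S] by simp
  also have "\<dots> \<le> (\<Sum>i\<in>J. (\<gamma> i)\<^sup>2)"
    using assms(1) by (intro sum_mono) (simp add: sum.delta')
  finally show ?thesis .
qed

text \<open>All phases are given up: |a_ij| <= sqrt (a_ii a_jj), and likewise for b, dominates the
  double sum by the square of a single one.\<close>

lemma kron_qf_bound:
  assumes a: "psd N a" and b: "psd N b" and N: "0 < N"
  shows "cmod (qf (N*N) (kron a b) v) \<le>
    (\<Sum>i<N*N. cmod (v i) * (sqrt (Re (a $$ (i div N, i div N))) * sqrt (Re (b $$ (i mod N, i mod N)))))\<^sup>2"
proof -
  define \<gamma> where "\<gamma> i = sqrt (Re (a $$ (i div N, i div N))) * sqrt (Re (b $$ (i mod N, i mod N)))" for i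
  have dims: "dim_row a = N" "dim_col a = N" "dim_row b = N" "dim_col b = N"
    using a b by (auto simp: psd_def)
  have entry: "cmod (kron a b $$ (i,j)) \<le> \<gamma> i * \<gamma> j" if "i < N*N" "j < N*N" for i j
  proof -
    have lt: "i div N < N" "j div N < N" "i mod N < N" "j mod N < N"
      using that N by (auto intro: less_mult_imp_div_less)
    have "cmod (kron a b $$ (i,j)) = cmod (a $$ (i div N, j div N)) * cmod (b $$ (i mod N, j mod N))"
      using that by (simp add: kron_def dims norm_mult)
    also have "\<dots> \<le> (sqrt (Re (a $$ (i div N, i div N))) * sqrt (Re (a $$ (j div N, j div N)))) *
        (sqrt (Re (b $$ (i mod N, i mod N))) * sqrt (Re (b $$ (j mod N, j mod N))))"
      using lt by (intro mult_mono psd_entry_bound(2)[OF a] psd_entry_bound(2)[OF b])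
        (simp_all add: psd_entry_bound(1)[OF a] )
    finally show ?thesis by (simp add: \<gamma>_def mult_ac)
  qed
  have "cmod (qf (N*N) (kron a b) v) \<le> (\<Sum>i<N*N. \<Sum>j<N*N. cmod (cnj (v i) * kron a b $$ (i,j) * v j))"
    unfolding qf_def by (intro order_trans[OF norm_sum] sum_mono norm_sum)
  also have "\<dots> \<le> (\<Sum>i<N*N. \<Sum>j<N*N. (cmod (v i) * \<gamma> i) * (cmod (v j) * \<gamma> j))"
  proof (intro sum_mono)
    fix i j assume "i \<in> {..<N*N}" "j \<in> {..<N*N}"
    then have "cmod (v i) * cmod (kron a b $$ (i,j)) * cmod (v j) \<le> cmod (v i) * (\<gamma> i * \<gamma> j) * cmod (v j)"
      using entry by (intro mult_right_mono mult_left_mono) auto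
    then show "cmod (cnj (v i) * kron a b $$ (i,j) * v j) \<le> (cmod (v i) * \<gamma> i) * (cmod (v j) * \<gamma> j)"
      by (simp add: norm_mult mult_ac)
  qed
  also have "\<dots> = (\<Sum>i<N*N. cmod (v i) * \<gamma> i)\<^sup>2"
    by (simp add: power2_eq_square sum_product)
  finally show ?thesis by (simp add: \<gamma>_def)
qed

text \<open>The vectors g s are described by their moduli only: a basis index m of one copy supports g s iff
  its two key bits agree and its key is s, and key and key bit determine m. After grouping the
  indices by their l-bit pattern, each vector of the tensor family meets each pattern at most once.\<close>

lemma product_state_overlap:
  fixes g :: "'s \<Rightarrow> nat \<Rightarrow> complex" and bt :: "nat \<Rightarrow> nat" and key :: "nat \<Rightarrow> 's"
  assumes D: "0 < D" and S: "finite S"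
    and g: "\<And>s m. m < D*D \<Longrightarrow>
        cmod (g s m) = (if bt (m div D) = bt (m mod D) \<and> key m = s then 1 / sqrt 2 else 0)"
    and inj: "\<And>m m'. \<lbrakk>m < D*D; m' < D*D; bt (m div D) = bt (m mod D); bt (m' div D) = bt (m' mod D);
        bt (m div D) = bt (m' div D); key m = key m'\<rbrakk> \<Longrightarrow> m = m'"
    and a: "is_state (D^l) a" and b: "is_state (D^l) b"
  shows "(\<Sum>\<sigma>\<in>{..<l} \<rightarrow>\<^sub>E S. Re (qf (D^l * D^l) (kron a b) (tens D l g \<sigma>))) \<le> (1/2) ^ l"
proof -
  define N where "N = D^l"
  have N: "0 < N" using D by (simp add: N_def)
  define bits where "bits x = restrict (\<lambda>k. bt (x div D^k mod D)) {..<l}" for x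
  define K where "K i = restrict (\<lambda>k. key (dig D l i k)) {..<l}" for i
  define al where "al x = Re (a $$ (x,x))" for x
  define be where "be x = Re (b $$ (x,x))" for x
  define \<gamma> where "\<gamma> i = sqrt (al (i div N)) * sqrt (be (i mod N))" for i
  define M where "M = bits ` {..<N}"
  \<comment> \<open>\<open>J m\<close> holds the indices at which both parties read the bit pattern
    m; \<open>A m\<close> and \<open>B m\<close> are the probabilities that a and b give to this
    pattern.\<close>
  define J where "J m = {i\<in>{..<N*N}. bits (i div N) = m \<and> bits (i mod N) = m}" for m
  define A where "A m = (\<Sum>x<N. if bits x = m then al x else 0)" for m
  define B where "B m = (\<Sum>x<N. if bits x = m then be x else 0)" for m
  define \<Gamma> where "\<Gamma> m \<sigma> = (\<Sum>i\<in>{i\<in>J m. K i = \<sigma>}. \<gamma> i)" for m \<sigma>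
  let ?S = "{..<l} \<rightarrow>\<^sub>E S"
  have finS: "finite ?S" using S by (intro finite_PiE) auto
  have pa: "psd N a" and pb: "psd N b" and ta: "mtrace a = 1" and tb: "mtrace b = 1"
    using a b by (auto simp: is_state_def N_def)
  have da: "dim_row a = N" and db: "dim_row b = N" using pa pb by (auto simp: psd_def)
  have al0: "0 \<le> al x" and be0: "0 \<le> be x" if "x < N" for x
    using psd_entry_bound(1)[OF pa that that] psd_entry_bound(1)[OF pb that that] by (simp_all add: al_def be_def)
  have bit_at: "bt (dig D l i k div D) = bits (i div N) k" "bt (dig D l i k mod D) = bits (i mod N) k"
    if "k < l" for i k
    using that by (simp_all add: bits_def dig_div[OF D] dig_mod N_def)
  \<comment> \<open>Within one pattern all key bits are fixed, so the keys determine the digits of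
    every copy.\<close>
  have injK: "inj_on K (J m)" for m
  proof (rule inj_onI)
    fix i j assume ij: "i \<in> J m" "j \<in> J m" "K i = K j"
    show "i = j"
    proof (rule dig_inject[OF D])
      show "i < D^l * D^l" "j < D^l * D^l" using ij by (simp_all add: J_def N_def)
      fix k assume k: "k < l"
      have "key (dig D l i k) = key (dig D l j k)"
        using fun_cong[OF ij(3), of k] k by (simp add: K_def)
      then show "dig D l i k = dig D l j k"
        using ij(1,2) k by (intro inj[of "dig D l i k" "dig D l j k"] dig_less[OF D])
          (simp_all add: bit_at J_def)
    qed
  qed
  \<comment> \<open>On its support a tensor vector has constant modulus 2^(-l/2), and the support
    splits according to the common pattern m.\<close>
  have amp: "(\<Sum>i<N*N. cmod (tens D l g \<sigma> i) * \<gamma> i) = (1 / sqrt 2) ^ l * (\<Sum>m\<in>M. \<Gamma> m \<sigma>)"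
    if \<sigma>: "\<sigma> \<in> ?S" for \<sigma>
  proof -
    have t: "cmod (tens D l g \<sigma> i) = (if bits (i div N) = bits (i mod N) \<and> K i = \<sigma> then (1 / sqrt 2) ^ l else 0)"
      if "i < N*N" for i
    proof -
      have "cmod (tens D l g \<sigma> i) = (\<Prod>k<l. if bits (i div N) k = bits (i mod N) k \<and> key (dig D l i k) = \<sigma> k then 1 / sqrt 2 else 0)"
        unfolding tens_def prod_norm[symmetric]
        by (intro prod.cong refl) (simp add: g dig_less[OF D] bit_at)
      also have "\<dots> = (if \<forall>k<l. bits (i div N) k = bits (i mod N) k \<and> key (dig D l i k) = \<sigma> k then (1 / sqrt 2) ^ l else 0)"
        by (auto intro!: prod_zero)
      also have "(\<forall>k<l. bits (i div N) k = bits (i mod N) k \<and> key (dig D l i k) = \<sigma> k) \<longleftrightarrow>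
          bits (i div N) = bits (i mod N) \<and> K i = \<sigma>"
      proof -
        have "bits (i div N) = bits (i mod N) \<longleftrightarrow> (\<forall>k<l. bits (i div N) k = bits (i mod N) k)"
          by (auto simp: bits_def restrict_def fun_eq_iff)
        moreover have "K i = \<sigma> \<longleftrightarrow> (\<forall>k<l. key (dig D l i k) = \<sigma> k)"
          using \<sigma> by (auto simp: K_def restrict_def fun_eq_iff PiE_iff extensional_def)
        ultimately show ?thesis by blast
      qed
      finally show ?thesis .
    qed
    have "(\<Sum>i<N*N. cmod (tens D l g \<sigma> i) * \<gamma> i) =
        (\<Sum>i<N*N. if bits (i div N) = bits (i mod N) \<and> K i = \<sigma> then (1 / sqrt 2) ^ l * \<gamma> i else 0)"
      by (intro sum.cong refl) (simp add: t)
    also have "\<dots> = (\<Sum>i\<in>{i\<in>{..<N*N}. bits (i div N) = bits (i mod N) \<and> K i = \<sigma>}. (1 / sqrt 2) ^ l * \<gamma> i)"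
      by (rule sum.inter_filter[symmetric]) simp
    also have "{i\<in>{..<N*N}. bits (i div N) = bits (i mod N) \<and> K i = \<sigma>} = (\<Union>m\<in>M. {i\<in>J m. K i = \<sigma>})"
      by (auto simp: J_def M_def intro!: less_mult_imp_div_less)
    also have "(\<Sum>i\<in>(\<Union>m\<in>M. {i\<in>J m. K i = \<sigma>}). (1 / sqrt 2) ^ l * \<gamma> i) =
        (\<Sum>m\<in>M. \<Sum>i\<in>{i\<in>J m. K i = \<sigma>}. (1 / sqrt 2) ^ l * \<gamma> i)"
      by (rule sum.UNION_disjoint) (auto simp: M_def J_def)
    finally show ?thesis by (simp add: \<Gamma>_def sum_distrib_left)
  qed
  have "(\<Sum>\<sigma>\<in>?S. Re (qf (N*N) (kron a b) (tens D l g \<sigma>))) \<le> (\<Sum>\<sigma>\<in>?S. (1/2) ^ l * (\<Sum>m\<in>M. \<Gamma> m \<sigma>)\<^sup>2)"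
  proof (intro sum_mono)
    fix \<sigma> assume \<sigma>: "\<sigma> \<in> ?S"
    have "Re (qf (N*N) (kron a b) (tens D l g \<sigma>)) \<le> (\<Sum>i<N*N. cmod (tens D l g \<sigma> i) * \<gamma> i)\<^sup>2"
      using kron_qf_bound[OF pa pb N, of "tens D l g \<sigma>"] complex_Re_le_cmod
      unfolding \<gamma>_def al_def be_def by (rule order_trans[rotated])
    also have "\<dots> = (1/2) ^ l * (\<Sum>m\<in>M. \<Gamma> m \<sigma>)\<^sup>2"
      by (simp add: amp[OF \<sigma>] power_mult_distrib power_divide power_mult[symmetric] mult.commute[of l])
        (simp add: power_mult)
    finally show "Re (qf (N*N) (kron a b) (tens D l g \<sigma>)) \<le> (1/2) ^ l * (\<Sum>m\<in>M. \<Gamma> m \<sigma>)\<^sup>2" .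
  qed
  \<comment> \<open>The sum over m stands inside the square; read as an L2 norm over \<sigma>, the
    total can be separated into patterns by Minkowski's inequality.\<close>
  also have "\<dots> = (1/2) ^ l * (L2_set (\<lambda>\<sigma>. \<Sum>m\<in>M. \<Gamma> m \<sigma>) ?S)\<^sup>2"
    by (simp add: L2_set_def sum_nonneg sum_distrib_left)
  also have "\<dots> \<le> (1/2) ^ l * 1\<^sup>2"
  proof (intro mult_left_mono power_mono)
    have "L2_set (\<lambda>\<sigma>. \<Sum>m\<in>M. \<Gamma> m \<sigma>) ?S \<le> (\<Sum>m\<in>M. L2_set (\<Gamma> m) ?S)" by (rule L2_set_sum_le)
    also have "\<dots> \<le> (\<Sum>m\<in>M. (A m + B m) / 2)"
    proof (intro sum_mono)
      fix m
      have A0: "0 \<le> A m" and B0: "0 \<le> B m" using al0 be0 by (auto simp: A_def B_def intro!: sum_nonneg)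
      have "(\<Sum>\<sigma>\<in>?S. (\<Gamma> m \<sigma>)\<^sup>2) \<le> (\<Sum>i\<in>J m. (\<gamma> i)\<^sup>2)"
        unfolding \<Gamma>_def by (rule sum_square_fibres[OF finS _ injK]) (simp add: J_def)
      also have "\<dots> = (\<Sum>i<N*N. if bits (i div N) = m \<and> bits (i mod N) = m then (\<gamma> i)\<^sup>2 else 0)"
        unfolding J_def by (rule sum.inter_filter) simp
      \<comment> \<open>\<open>J m\<close> is a product set and the square of
        \<open>\<gamma>\<close> is a product, so the sum factors into the two probabilities.\<close>
      also have "\<dots> = (\<Sum>i<N*N. (if bits (i div N) = m then al (i div N) else 0) *
          (if bits (i mod N) = m then be (i mod N) else 0))"
        using N al0 be0 by (intro sum.cong refl)
          (auto simp: \<gamma>_def power_mult_distrib less_mult_imp_div_less)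
      also have "\<dots> = A m * B m"
        by (simp only: sum_div_mod[OF N, where h = "\<lambda>x y. (if bits x = m then al x else 0) *
          (if bits y = m then be y else 0)"] A_def B_def sum_product)
      finally have "L2_set (\<Gamma> m) ?S \<le> sqrt (A m * B m)"
        by (simp add: L2_set_def)
      also have "\<dots> \<le> (A m + B m) / 2" using A0 B0 by (rule arith_geo_mean_sqrt)
      finally show "L2_set (\<Gamma> m) ?S \<le> (A m + B m) / 2" .
    qed
    also have "\<dots> = ((\<Sum>m\<in>M. A m) + (\<Sum>m\<in>M. B m)) / 2"
      by (simp add: sum_divide_distrib[symmetric] sum.distrib)
    \<comment> \<open>Each x has exactly one pattern, which lies in \<open>M\<close>, so the
      probabilities add up to the trace.\<close>
    also have "(\<Sum>m\<in>M. A m) = 1"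
    proof -
      have "(\<Sum>m\<in>M. A m) = (\<Sum>x<N. \<Sum>m\<in>M. if bits x = m then al x else 0)"
        unfolding A_def by (rule sum.swap)
      also have "\<dots> = (\<Sum>x<N. al x)" by (intro sum.cong refl) (simp add: M_def)
      also have "\<dots> = Re (mtrace a)" by (simp add: mtrace_def al_def da)
      finally show ?thesis by (simp add: ta)
    qed
    also have "(\<Sum>m\<in>M. B m) = 1"
    proof -
      have "(\<Sum>m\<in>M. B m) = (\<Sum>x<N. \<Sum>m\<in>M. if bits x = m then be x else 0)"
        unfolding B_def by (rule sum.swap)
      also have "\<dots> = (\<Sum>x<N. be x)" by (intro sum.cong refl) (simp add: M_def)
      also have "\<dots> = Re (mtrace b)" by (simp add: mtrace_def be_def db)
      finally show ?thesis by (simp add: tb)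
    qed
    finally show "L2_set (\<lambda>\<sigma>. \<Sum>m\<in>M. \<Gamma> m \<sigma>) ?S \<le> 1" by simp
  qed simp_all
  finally show ?thesis by (simp add: N_def)
qed

lemma qf_weighted_sum:
  assumes "\<And>i j. i < n \<Longrightarrow> j < n \<Longrightarrow> M $$ (i,j) = (\<Sum>t<k::nat. of_real (w t) * R t $$ (i,j))"
  shows "qf n M v = (\<Sum>t<k. of_real (w t) * qf n (R t) v)"
proof -
  have "qf n M v = (\<Sum>i<n. \<Sum>j<n. \<Sum>t<k. of_real (w t) * (cnj (v i) * R t $$ (i,j) * v j))"
    unfolding qf_def by (intro sum.cong refl) (simp add: assms sum_distrib_left sum_distrib_right mult_ac)
  also have "\<dots> = (\<Sum>i<n. \<Sum>t<k. \<Sum>j<n. of_real (w t) * (cnj (v i) * R t $$ (i,j) * v j))"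
    by (intro sum.cong refl sum.swap)
  also have "\<dots> = (\<Sum>t<k. \<Sum>i<n. \<Sum>j<n. of_real (w t) * (cnj (v i) * R t $$ (i,j) * v j))"
    by (rule sum.swap)
  finally show ?thesis by (simp add: qf_def sum_distrib_left)
qed

lemma SEP_statesD:
  assumes "\<sigma> \<in> SEP_states d1 d2"
  shows "\<exists>k w a b. (\<forall>t<k::nat. (0::real) \<le> w t \<and> is_state d1 (a t) \<and> is_state d2 (b t)) \<and> (\<Sum>t<k. w t) = 1 \<and>
    \<sigma> \<in> carrier_mat (d1*d2) (d1*d2) \<and>
    (\<forall>i<d1*d2. \<forall>j<d1*d2. \<sigma> $$ (i,j) = (\<Sum>t<k. of_real (w t) * kron (a t) (b t) $$ (i,j)))"
proof -
  obtain k w a b where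
    \<sigma>: "\<sigma> = mat (d1*d2) (d1*d2) (\<lambda>(i,j). \<Sum>t<k::nat. complex_of_real (w t) * kron (a t) (b t) $$ (i,j))"
    and p: "\<forall>t<k. w t \<ge> 0 \<and> is_state d1 (a t) \<and> is_state d2 (b t)" and w: "(\<Sum>t<k. w t) = 1"
    using assms unfolding SEP_states_def by blast
  show ?thesis
    by (rule exI[of _ k], rule exI[of _ w], rule exI[of _ a], rule exI[of _ b]) (use p w in \<open>simp add: \<sigma>\<close>)
qed

text \<open>The overlap is linear in the state, so the bound for product states passes to convex
  combinations.\<close>

lemma separable_overlap:
  fixes g :: "'s \<Rightarrow> nat \<Rightarrow> complex" and bt :: "nat \<Rightarrow> nat" and key :: "nat \<Rightarrow> 's"
  assumes "0 < D" "finite S"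
    and "\<And>s m. m < D*D \<Longrightarrow>
        cmod (g s m) = (if bt (m div D) = bt (m mod D) \<and> key m = s then 1 / sqrt 2 else 0)"
    and "\<And>m m'. \<lbrakk>m < D*D; m' < D*D; bt (m div D) = bt (m mod D); bt (m' div D) = bt (m' mod D);
        bt (m div D) = bt (m' div D); key m = key m'\<rbrakk> \<Longrightarrow> m = m'"
    and sep: "\<rho> \<in> SEP_states (D^l) (D^l)"
  shows "(\<Sum>\<sigma>\<in>{..<l} \<rightarrow>\<^sub>E S. Re (qf (D^l * D^l) \<rho> (tens D l g \<sigma>))) \<le> (1/2) ^ l"
proof -
  obtain k w a b where p: "\<forall>t<k::nat. (0::real) \<le> w t \<and> is_state (D^l) (a t) \<and> is_state (D^l) (b t)"
    and w1: "(\<Sum>t<k. w t) = 1" and c: "\<rho> \<in> carrier_mat (D^l*D^l) (D^l*D^l)"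
    and e: "\<forall>i<D^l*D^l. \<forall>j<D^l*D^l. \<rho> $$ (i,j) = (\<Sum>t<k. of_real (w t) * kron (a t) (b t) $$ (i,j))"
    using SEP_statesD[OF sep] by blast
  have w: "0 \<le> w t" and a: "is_state (D^l) (a t)" and b: "is_state (D^l) (b t)" if "t < k" for t
    using p that by auto
  note e = e[rule_format]
  let ?q = "\<lambda>t \<sigma>. Re (qf (D^l * D^l) (kron (a t) (b t)) (tens D l g \<sigma>))"
  have "(\<Sum>\<sigma>\<in>{..<l} \<rightarrow>\<^sub>E S. Re (qf (D^l * D^l) \<rho> (tens D l g \<sigma>))) =
      (\<Sum>\<sigma>\<in>{..<l} \<rightarrow>\<^sub>E S. \<Sum>t<k. w t * ?q t \<sigma>)"
    by (simp add: qf_weighted_sum[OF e, of "D^l*D^l"])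
  also have "\<dots> = (\<Sum>t<k. w t * (\<Sum>\<sigma>\<in>{..<l} \<rightarrow>\<^sub>E S. ?q t \<sigma>))"
    unfolding sum_distrib_left by (rule sum.swap)
  also have "\<dots> \<le> (\<Sum>t<k. w t * (1/2) ^ l)"
  proof (intro sum_mono mult_left_mono)
    fix t assume "t \<in> {..<k}"
    then have t: "t < k" by simp
    show "(\<Sum>\<sigma>\<in>{..<l} \<rightarrow>\<^sub>E S. ?q t \<sigma>) \<le> (1/2) ^ l"
      by (rule product_state_overlap[OF assms(1-4) a[OF t] b[OF t]])
    show "0 \<le> w t" by (rule w[OF t])
  qed
  also have "\<dots> = (1/2) ^ l" by (simp add: sum_distrib_right[symmetric] w1)
  finally show ?thesis .
qed

lemma herm_separable:
  assumes "\<rho> \<in> SEP_states d1 d2"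
  shows "herm (d1*d2) \<rho>"
proof -
  obtain k w a b where p: "\<forall>t<k::nat. (0::real) \<le> w t \<and> is_state d1 (a t) \<and> is_state d2 (b t)"
    and w1: "(\<Sum>t<k. w t) = 1" and c: "\<rho> \<in> carrier_mat (d1*d2) (d1*d2)"
    and e: "\<forall>i<d1*d2. \<forall>j<d1*d2. \<rho> $$ (i,j) = (\<Sum>t<k. of_real (w t) * kron (a t) (b t) $$ (i,j))"
    using SEP_statesD[OF assms] by blast
  have w: "0 \<le> w t" and a: "is_state d1 (a t)" and b: "is_state d2 (b t)" if "t < k" for t
    using p that by auto
  note e = e[rule_format]
  have kr: "kron (a t) (b t) $$ (i,j) = cnj (kron (a t) (b t) $$ (j,i))" if "t < k" "i < d1*d2" "j < d1*d2" for t i j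
  proof -
    have h: "herm d1 (a t)" "herm d2 (b t)" using a b that by (auto simp: is_state_def psd_imp_herm)
    have d2: "0 < d2" using that by (cases d2) auto
    have lt: "i div d2 < d1" "j div d2 < d1" "i mod d2 < d2" "j mod d2 < d2"
      using that d2 by (auto intro: less_mult_imp_div_less)
    have dims: "dim_row (a t) = d1" "dim_col (a t) = d1" "dim_row (b t) = d2" "dim_col (b t) = d2"
      using h unfolding herm_def by auto
    have "a t $$ (i div d2, j div d2) = cnj (a t $$ (j div d2, i div d2))"
      "b t $$ (i mod d2, j mod d2) = cnj (b t $$ (j mod d2, i mod d2))"
      using h lt unfolding herm_def by blast+
    then show ?thesis using that by (simp add: kron_def dims)
  qed
  show ?thesis using c unfolding herm_def
  proof (intro conjI allI impI)
    fix i j assume ij: "i < d1*d2" "j < d1*d2"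
    show "\<rho> $$ (i,j) = cnj (\<rho> $$ (j,i))"
      unfolding e[OF ij] e[OF ij(2,1)] cnj_sum complex_cnj_mult complex_cnj_complex_of_real
      using kr[OF _ ij] by (intro sum.cong refl) auto
  qed
qed

lemma mtrace_kron:
  assumes "a \<in> carrier_mat m m" "b \<in> carrier_mat n n" "0 < n"
  shows "mtrace (kron a b) = mtrace a * mtrace b"
proof -
  have "mtrace (kron a b) = (\<Sum>i<m*n. a $$ (i div n, i div n) * b $$ (i mod n, i mod n))"
    using assms unfolding mtrace_def by (intro sum.cong) (auto simp: kron_def)
  also have "\<dots> = (\<Sum>x<m. \<Sum>y<n. a $$ (x,x) * b $$ (y,y))"
    by (rule sum_div_mod[OF assms(3), where h = "\<lambda>x y. a $$ (x,x) * b $$ (y,y)"])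
  finally show ?thesis using assms(1,2) by (simp add: mtrace_def sum_product)
qed

lemma mtrace_separable:
  assumes "\<rho> \<in> SEP_states d1 d2" "0 < d2"
  shows "mtrace \<rho> = 1"
proof -
  obtain k w a b where p: "\<forall>t<k::nat. (0::real) \<le> w t \<and> is_state d1 (a t) \<and> is_state d2 (b t)"
    and w1: "(\<Sum>t<k. w t) = 1" and c: "\<rho> \<in> carrier_mat (d1*d2) (d1*d2)"
    and e: "\<forall>i<d1*d2. \<forall>j<d1*d2. \<rho> $$ (i,j) = (\<Sum>t<k. of_real (w t) * kron (a t) (b t) $$ (i,j))"
    using SEP_statesD[OF assms(1)] by blast
  have w: "0 \<le> w t" and a: "is_state d1 (a t)" and b: "is_state d2 (b t)" if "t < k" for t
    using p that by auto
  note e = e[rule_format]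
  have t1: "mtrace (kron (a t) (b t)) = 1" "dim_row (kron (a t) (b t)) = d1*d2" if "t < k" for t
  proof -
    have "a t \<in> carrier_mat d1 d1" "b t \<in> carrier_mat d2 d2" "mtrace (a t) = 1" "mtrace (b t) = 1"
      using a[OF that] b[OF that] by (auto simp: is_state_def psd_def)
    then show "mtrace (kron (a t) (b t)) = 1" "dim_row (kron (a t) (b t)) = d1*d2"
      using assms(2) by (simp_all add: mtrace_kron) (simp add: kron_def)
  qed
  have "mtrace \<rho> = (\<Sum>i<d1*d2. \<Sum>t<k. of_real (w t) * kron (a t) (b t) $$ (i,i))"
    using c unfolding mtrace_def by (intro sum.cong) (auto simp: e)
  also have "\<dots> = (\<Sum>t<k. of_real (w t) * mtrace (kron (a t) (b t)))"
    by (subst sum.swap) (simp add: mtrace_def t1 sum_distrib_left)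
  also have "\<dots> = of_real (\<Sum>t<k. w t)" by (simp add: t1)
  finally show ?thesis by (simp add: w1)
qed

section \<open>The state\<close>

definition diagm :: "nat \<Rightarrow> (nat \<Rightarrow> real) \<Rightarrow> complex mat" where
  "diagm n c = mat n n (\<lambda>(i,j). if i = j then of_real (c i) else 0)"

lemma psd_diagm:
  assumes "\<And>i. i < n \<Longrightarrow> 0 \<le> c i"
  shows "psd n (diagm n c)"
proof -
  have "qf n (diagm n c) v = of_real (\<Sum>i<n. c i * (cmod (v i))\<^sup>2)" for v
  proof -
    have "qf n (diagm n c) v = (\<Sum>i<n. \<Sum>j<n. if i = j then of_real (c i) * (v i * cnj (v i)) else 0)"
      unfolding qf_def by (intro sum.cong refl) (simp add: diagm_def mult_ac)
    also have "\<dots> = (\<Sum>i<n. of_real (c i) * (v i * cnj (v i)))" by simp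
    finally show ?thesis by (simp only: of_real_sum of_real_mult complex_norm_square)
  qed
  moreover have "0 \<le> (\<Sum>i<n. c i * (cmod (v i))\<^sup>2)" for v
    using assms by (intro sum_nonneg) simp
  moreover have "diagm n c \<in> carrier_mat n n" by (simp add: diagm_def)
  ultimately show ?thesis unfolding psd_iff_qf by (metis Im_complex_of_real Re_complex_of_real)
qed

text \<open>All four square roots in the blocks of rho are roots of diagonal matrices and are
  evaluated by this rule.\<close>

lemma msqrt_diagm:
  assumes "\<And>i. i < n \<Longrightarrow> 0 \<le> c i"
  shows "msqrt (diagm n (\<lambda>i. (c i)\<^sup>2)) = diagm n c"
proof (rule msqrt_eqI)
  show "psd n (diagm n c)" by (rule psd_diagm[OF assms])
  show "diagm n (\<lambda>i. (c i)\<^sup>2) = diagm n c * diagm n c"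
  proof (rule eq_matI)
    fix i j assume "i < dim_row (diagm n c * diagm n c)" "j < dim_col (diagm n c * diagm n c)"
    then have ij: "i < n" "j < n" by (simp_all add: diagm_def)
    have "(diagm n c * diagm n c) $$ (i,j) = (\<Sum>k<n. diagm n c $$ (i,k) * diagm n c $$ (k,j))"
      using ij by (simp add: diagm_def scalar_prod_def atLeast0LessThan)
    also have "\<dots> = (\<Sum>k<n. if k = i then (if i = j then of_real ((c i)\<^sup>2) else 0) else 0)"
      using ij by (intro sum.cong refl) (auto simp: diagm_def power2_eq_square)
    also have "\<dots> = (if i = j then of_real ((c i)\<^sup>2) else 0)" using ij by (simp add: sum.delta)
    finally show "diagm n (\<lambda>i. (c i)\<^sup>2) $$ (i,j) = (diagm n c * diagm n c) $$ (i,j)"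
      using ij by (simp add: diagm_def)
  qed (simp_all add: diagm_def)
qed

lemma mult_cadj_index:
  assumes "A \<in> carrier_mat n n" "i < n" "j < n"
  shows "(A * cadj A) $$ (i,j) = (\<Sum>k<n. A $$ (i,k) * cnj (A $$ (j,k)))"
    and "(cadj A * A) $$ (i,j) = (\<Sum>k<n. cnj (A $$ (k,i)) * A $$ (k,j))"
  using assms by (auto simp: cadj_def scalar_prod_def atLeast0LessThan intro!: sum.cong)

lemma sum_sum_pair_index:
  fixes n r :: nat and f :: "nat \<Rightarrow> nat \<Rightarrow> complex"
  assumes "r < n * n"
  shows "(\<Sum>i<n. \<Sum>j<n. if r = i * n + j \<and> P i j then f i j else 0) =
    (if P (r div n) (r mod n) then f (r div n) (r mod n) else 0)"
proof -
  have n: "0 < n" using assms by (cases n) auto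
  have "(\<Sum>i<n. \<Sum>j<n. if r = i * n + j \<and> P i j then f i j else 0) =
      (\<Sum>i<n. \<Sum>j<n. if i = r div n then (if j = r mod n then (if P i j then f i j else 0) else 0) else 0)"
  proof (intro sum.cong refl)
    fix i j assume "i \<in> {..<n}" "j \<in> {..<n}"
    then have "r = i * n + j \<longleftrightarrow> i = r div n \<and> j = r mod n" by auto
    then show "(if r = i * n + j \<and> P i j then f i j else 0) =
        (if i = r div n then (if j = r mod n then (if P i j then f i j else 0) else 0) else 0)" by auto
  qed
  also have "\<dots> = (\<Sum>i<n. if i = r div n then (\<Sum>j<n. if j = r mod n then (if P i j then f i j else 0) else 0) else 0)"
    by (intro sum.cong refl) simp
  also have "\<dots> = (if P (r div n) (r mod n) then f (r div n) (r mod n) else 0)"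
    using assms n by (simp add: less_mult_imp_div_less)
  finally show ?thesis .
qed

text \<open>The flip |xy> to |yx> on A'B', acting on indices.\<close>

definition swap_idx :: "nat \<Rightarrow> nat \<Rightarrow> nat" where
  "swap_idx n r = (r mod n) * n + r div n"

lemma swap_idx:
  assumes "r < n * n"
  shows "swap_idx n r < n * n" "swap_idx n (swap_idx n r) = r"
    "swap_idx n r div n = r mod n" "swap_idx n r mod n = r div n"
proof -
  have n: "0 < n" using assms by (cases n) auto
  have "r div n < n" "r mod n < n" using assms n by (auto simp: less_mult_imp_div_less)
  then show "swap_idx n r < n * n" "swap_idx n r div n = r mod n" "swap_idx n r mod n = r div n"
    by (auto simp: swap_idx_def pair_index_less)
  then show "swap_idx n (swap_idx n r) = r" by (subst swap_idx_def) simp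
qed

lemma Xop_index:
  assumes "r < n * n" "s < n * n"
  shows "Xop n U $$ (r,s) =
    (if s = swap_idx n r then U $$ (r div n, r mod n) / of_real (n * sqrt n) else 0)"
  using assms sum_sum_pair_index[OF assms(1), where P = "\<lambda>i j. s = j * n + i"
      and f = "\<lambda>i j. U $$ (i,j) / of_real (n * sqrt n)"]
  by (simp add: Xop_def swap_idx_def)

lemma Yop_index:
  assumes "r < n * n" "s < n * n"
  shows "Yop n U $$ (r,s) =
    (if r div n = r mod n \<and> s div n = s mod n then U $$ (r div n, s div n) / of_nat n else 0)"
proof -
  have n: "0 < n" using assms by (cases n) auto
  have "Yop n U $$ (r,s) = (\<Sum>i<n. \<Sum>j<n. if r = i * n + i \<and> s = j * n + j then U $$ (i,j) / of_nat n else 0)"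
    using assms by (simp add: Yop_def)
  also have "\<dots> = (\<Sum>i<n. \<Sum>j<n. if i = r div n then (if j = s div n then
      (if r div n = r mod n \<and> s div n = s mod n then U $$ (i,j) / of_nat n else 0) else 0) else 0)"
  proof (intro sum.cong refl)
    fix i j assume ij: "i \<in> {..<n}" "j \<in> {..<n}"
    have *: "t = k * n + k \<longleftrightarrow> k = t div n \<and> t div n = t mod n" if "k < n" for t k
      using that by (metis add.commute div_mult_mod_eq div_mult_self3 div_less mod_mult_self3 mod_less add.left_neutral n not_less0)
    show "(if r = i * n + i \<and> s = j * n + j then U $$ (i,j) / of_nat n else 0) =
      (if i = r div n then (if j = s div n then
      (if r div n = r mod n \<and> s div n = s mod n then U $$ (i,j) / of_nat n else 0) else 0) else 0)"
      using ij by (auto simp: *)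
  qed
  also have "\<dots> = (\<Sum>i<n. if i = r div n then (\<Sum>j<n. if j = s div n then
      (if r div n = r mod n \<and> s div n = s mod n then U $$ (i,j) / of_nat n else 0) else 0) else 0)"
    by (intro sum.cong refl) simp
  also have "\<dots> = (if r div n = r mod n \<and> s div n = s mod n then U $$ (r div n, s div n) / of_nat n else 0)"
    using assms n by (simp add: less_mult_imp_div_less)
  finally show ?thesis .
qed

lemma flat_unitary_norm_sq:
  assumes "flat_unitary n U" "i < n" "j < n"
  shows "U $$ (i,j) * cnj (U $$ (i,j)) = of_real (1 / n)"
  using assms unfolding complex_norm_square[symmetric]
  by (simp add: flat_unitary_def power_divide)

lemma flat_unitary_rows:
  assumes "flat_unitary n U" "i < n" "j < n"
  shows "(\<Sum>k<n. U $$ (i,k) * cnj (U $$ (j,k))) = (if i = j then 1 else 0)"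
    and "(\<Sum>k<n. cnj (U $$ (k,i)) * U $$ (k,j)) = (if i = j then 1 else 0)"
proof -
  have U: "U \<in> carrier_mat n n" "U * cadj U = 1\<^sub>m n" "cadj U * U = 1\<^sub>m n"
    using assms(1) by (auto simp: flat_unitary_def)
  show "(\<Sum>k<n. U $$ (i,k) * cnj (U $$ (j,k))) = (if i = j then 1 else 0)"
    using mult_cadj_index(1)[OF U(1) assms(2,3)] U(2) assms(2,3) by simp
  show "(\<Sum>k<n. cnj (U $$ (k,i)) * U $$ (k,j)) = (if i = j then 1 else 0)"
    using mult_cadj_index(2)[OF U(1) assms(2,3)] U(3) assms(2,3) by simp
qed

lemma Xop_carrier: "Xop n U \<in> carrier_mat (n*n) (n*n)"
  by (simp add: Xop_def)

lemma Yop_carrier: "Yop n U \<in> carrier_mat (n*n) (n*n)"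
  by (simp add: Yop_def)

text \<open>X is a weighted flip. Flatness gives every weight the modulus 1/n^2, namely 1/sqrt n
  divided by n sqrt n, so both products with the adjoint are n^(-4) times the identity.\<close>

lemma msqrt_Xop:
  assumes U: "flat_unitary n U"
  shows "msqrt (Xop n U * cadj (Xop n U)) = diagm (n*n) (\<lambda>_. 1 / (real n)\<^sup>2)"
    and "msqrt (cadj (Xop n U) * Xop n U) = diagm (n*n) (\<lambda>_. 1 / (real n)\<^sup>2)"
proof -
  have nrm: "U $$ (r div n, r mod n) / of_real (n * sqrt n) * cnj (U $$ (r div n, r mod n) / of_real (n * sqrt n))
      = of_real ((1 / (real n)\<^sup>2)\<^sup>2)" if "r < n*n" for r
  proof -
    have n: "0 < n" using that by (cases n) auto
    have "U $$ (r div n, r mod n) / of_real (n * sqrt n) * cnj (U $$ (r div n, r mod n) / of_real (n * sqrt n))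
      = (U $$ (r div n, r mod n) * cnj (U $$ (r div n, r mod n))) / of_real ((n * sqrt n) * (n * sqrt n))"
      by simp
    also have "\<dots> = of_real (1 / n / ((n * sqrt n) * (n * sqrt n)))"
      using that n by (subst flat_unitary_norm_sq[OF U]) (auto simp: less_mult_imp_div_less)
    also have "1 / n / ((n * sqrt n) * (n * sqrt n)) = (1 / (real n)\<^sup>2)\<^sup>2"
      using n by (simp add: field_simps power2_eq_square)
    finally show ?thesis .
  qed
  have "Xop n U * cadj (Xop n U) = diagm (n*n) (\<lambda>_. (1 / (real n)\<^sup>2)\<^sup>2)"
  proof (rule eq_matI)
    fix r s assume "r < dim_row (diagm (n*n) (\<lambda>_. (1 / (real n)\<^sup>2)\<^sup>2))" "s < dim_col (diagm (n*n) (\<lambda>_. (1 / (real n)\<^sup>2)\<^sup>2))"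
    then have rs: "r < n*n" "s < n*n" by (simp_all add: diagm_def)
    have "(Xop n U * cadj (Xop n U)) $$ (r,s) = (\<Sum>k<n*n. if k = swap_idx n r then
        (if r = s then of_real ((1 / (real n)\<^sup>2)\<^sup>2) else 0) else 0)"
      unfolding mult_cadj_index(1)[OF Xop_carrier rs]
    proof (intro sum.cong refl)
      fix k assume "k \<in> {..<n*n}"
      moreover have "swap_idx n r = swap_idx n s \<longleftrightarrow> r = s" using swap_idx(2) rs by metis
      ultimately show "Xop n U $$ (r,k) * cnj (Xop n U $$ (s,k)) = (if k = swap_idx n r then
          (if r = s then of_real ((1 / (real n)\<^sup>2)\<^sup>2) else 0) else 0)"
        using rs nrm[OF rs(1)] nrm[OF rs(2)] by (simp add: Xop_index)
    qed
    then show "(Xop n U * cadj (Xop n U)) $$ (r,s) = diagm (n*n) (\<lambda>_. (1 / (real n)\<^sup>2)\<^sup>2) $$ (r,s)"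
      using rs swap_idx(1)[OF rs(1)] by (simp add: diagm_def)
  qed (simp_all add: diagm_def cadj_def Xop_def)
  then show "msqrt (Xop n U * cadj (Xop n U)) = diagm (n*n) (\<lambda>_. 1 / (real n)\<^sup>2)"
    using msqrt_diagm[of "n*n" "\<lambda>_. 1 / (real n)\<^sup>2"] by simp
  have "cadj (Xop n U) * Xop n U = diagm (n*n) (\<lambda>_. (1 / (real n)\<^sup>2)\<^sup>2)"
  proof (rule eq_matI)
    fix r s assume "r < dim_row (diagm (n*n) (\<lambda>_. (1 / (real n)\<^sup>2)\<^sup>2))" "s < dim_col (diagm (n*n) (\<lambda>_. (1 / (real n)\<^sup>2)\<^sup>2))"
    then have rs: "r < n*n" "s < n*n" by (simp_all add: diagm_def)
    have "(cadj (Xop n U) * Xop n U) $$ (r,s) = (\<Sum>k<n*n. if k = swap_idx n r then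
        (if r = s then of_real ((1 / (real n)\<^sup>2)\<^sup>2) else 0) else 0)"
      unfolding mult_cadj_index(2)[OF Xop_carrier rs]
    proof (intro sum.cong refl)
      fix k assume "k \<in> {..<n*n}"
      then have k: "k < n*n" by simp
      have "t = swap_idx n k \<longleftrightarrow> k = swap_idx n t" if "t < n*n" for t
        using swap_idx(2)[OF k] swap_idx(2)[OF that] by metis
      then show "cnj (Xop n U $$ (k,r)) * Xop n U $$ (k,s) = (if k = swap_idx n r then
          (if r = s then of_real ((1 / (real n)\<^sup>2)\<^sup>2) else 0) else 0)"
        using rs k nrm[OF k] swap_idx(2)[OF rs(1)] swap_idx(2)[OF rs(2)]
        by (auto simp: Xop_index mult.commute)
    qed
    then show "(cadj (Xop n U) * Xop n U) $$ (r,s) = diagm (n*n) (\<lambda>_. (1 / (real n)\<^sup>2)\<^sup>2) $$ (r,s)"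
      using rs swap_idx(1)[OF rs(1)] by (simp add: diagm_def)
  qed (simp_all add: diagm_def cadj_def Xop_def)
  then show "msqrt (cadj (Xop n U) * Xop n U) = diagm (n*n) (\<lambda>_. 1 / (real n)\<^sup>2)"
    using msqrt_diagm[of "n*n" "\<lambda>_. 1 / (real n)\<^sup>2"] by simp
qed

lemma sum_diagonal_pairs:
  fixes f :: "nat \<Rightarrow> complex"
  assumes "0 < n"
  shows "(\<Sum>k<n*n. if k div n = k mod n then f (k div n) else 0) = (\<Sum>x<n. f x)"
proof -
  have "(\<Sum>k<n*n. if k div n = k mod n then f (k div n) else 0) = (\<Sum>x<n. \<Sum>y<n. if x = y then f x else 0)"
    by (rule sum_div_mod[OF assms])
  then show ?thesis by simp
qed

text \<open>Y acts as U/n on the span of the |xx> and as zero on its complement; unitarity turns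
  both products into n^(-2) times the projection onto that span.\<close>

lemma msqrt_Yop:
  assumes U: "flat_unitary n U"
  shows "msqrt (Yop n U * cadj (Yop n U)) = diagm (n*n) (\<lambda>r. if r div n = r mod n then 1 / real n else 0)"
    and "msqrt (cadj (Yop n U) * Yop n U) = diagm (n*n) (\<lambda>r. if r div n = r mod n then 1 / real n else 0)"
proof -
  let ?c = "\<lambda>r. if r div n = r mod n then 1 / real n else 0"
  have eq: "r = s" if "r div n = r mod n" "s div n = s mod n" "r div n = s div n" for r s
    using that by (metis div_mult_mod_eq)
  have "Yop n U * cadj (Yop n U) = diagm (n*n) (\<lambda>r. (?c r)\<^sup>2)"
  proof (rule eq_matI)
    fix r s assume "r < dim_row (diagm (n*n) (\<lambda>r. (?c r)\<^sup>2))" "s < dim_col (diagm (n*n) (\<lambda>r. (?c r)\<^sup>2))"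
    then have rs: "r < n*n" "s < n*n" by (simp_all add: diagm_def)
    then have n: "0 < n" by (cases n) auto
    show "(Yop n U * cadj (Yop n U)) $$ (r,s) = diagm (n*n) (\<lambda>r. (?c r)\<^sup>2) $$ (r,s)"
    proof (cases "r div n = r mod n \<and> s div n = s mod n")
      case True
      have "(Yop n U * cadj (Yop n U)) $$ (r,s) = (\<Sum>k<n*n. if k div n = k mod n then
          U $$ (r div n, k div n) * cnj (U $$ (s div n, k div n)) / (of_nat n)\<^sup>2 else 0)"
        unfolding mult_cadj_index(1)[OF Yop_carrier rs] using rs True
        by (intro sum.cong refl) (simp add: Yop_index power2_eq_square)
      also have "\<dots> = (\<Sum>x<n. U $$ (r div n, x) * cnj (U $$ (s div n, x))) / (of_nat n)\<^sup>2"
        unfolding sum_diagonal_pairs[OF n, of "\<lambda>x. U $$ (r div n, x) * cnj (U $$ (s div n, x)) / (of_nat n)\<^sup>2"]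
        by (simp add: sum_divide_distrib)
      also have "\<dots> = (if r div n = s div n then 1 else 0) / (of_nat n)\<^sup>2"
        using rs n by (subst flat_unitary_rows(1)[OF U]) (auto simp: less_mult_imp_div_less)
      finally show ?thesis using rs True eq[of r s] by (auto simp: diagm_def power_divide)
    next
      case False
      have "(Yop n U * cadj (Yop n U)) $$ (r,s) = 0"
        unfolding mult_cadj_index(1)[OF Yop_carrier rs] using rs False
        by (intro sum.neutral) (auto simp: Yop_index)
      then show ?thesis using rs False by (auto simp: diagm_def)
    qed
  qed (simp_all add: diagm_def cadj_def Yop_def)
  then show "msqrt (Yop n U * cadj (Yop n U)) = diagm (n*n) ?c"
    using msqrt_diagm[of "n*n" ?c] by simp
  have "cadj (Yop n U) * Yop n U = diagm (n*n) (\<lambda>r. (?c r)\<^sup>2)"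
  proof (rule eq_matI)
    fix r s assume "r < dim_row (diagm (n*n) (\<lambda>r. (?c r)\<^sup>2))" "s < dim_col (diagm (n*n) (\<lambda>r. (?c r)\<^sup>2))"
    then have rs: "r < n*n" "s < n*n" by (simp_all add: diagm_def)
    then have n: "0 < n" by (cases n) auto
    show "(cadj (Yop n U) * Yop n U) $$ (r,s) = diagm (n*n) (\<lambda>r. (?c r)\<^sup>2) $$ (r,s)"
    proof (cases "r div n = r mod n \<and> s div n = s mod n")
      case True
      have "(cadj (Yop n U) * Yop n U) $$ (r,s) = (\<Sum>k<n*n. if k div n = k mod n then
          cnj (U $$ (k div n, r div n)) * U $$ (k div n, s div n) / (of_nat n)\<^sup>2 else 0)"
        unfolding mult_cadj_index(2)[OF Yop_carrier rs] using rs True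
        by (intro sum.cong refl) (simp add: Yop_index power2_eq_square)
      also have "\<dots> = (\<Sum>x<n. cnj (U $$ (x, r div n)) * U $$ (x, s div n)) / (of_nat n)\<^sup>2"
        unfolding sum_diagonal_pairs[OF n, of "\<lambda>x. cnj (U $$ (x, r div n)) * U $$ (x, s div n) / (of_nat n)\<^sup>2"]
        by (simp add: sum_divide_distrib)
      also have "\<dots> = (if r div n = s div n then 1 else 0) / (of_nat n)\<^sup>2"
        using rs n by (subst flat_unitary_rows(2)[OF U]) (auto simp: less_mult_imp_div_less)
      finally show ?thesis using rs True eq[of r s] by (auto simp: diagm_def power_divide)
    next
      case False
      have "(cadj (Yop n U) * Yop n U) $$ (r,s) = 0"
        unfolding mult_cadj_index(2)[OF Yop_carrier rs] using rs False
        by (intro sum.neutral) (auto simp: Yop_index)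
      then show ?thesis using rs False by (auto simp: diagm_def)
    qed
  qed (simp_all add: diagm_def cadj_def Yop_def)
  then show "msqrt (cadj (Yop n U) * Yop n U) = diagm (n*n) ?c"
    using msqrt_diagm[of "n*n" ?c] by simp
qed

text \<open>The entry of rho between |a b x y> and |a' b' x' y'> (A, B, A', B').\<close>

definition rho_entry ::
  "nat \<Rightarrow> complex mat \<Rightarrow> nat \<Rightarrow> nat \<Rightarrow> nat \<Rightarrow> nat \<Rightarrow> nat \<Rightarrow> nat \<Rightarrow> nat \<Rightarrow> nat \<Rightarrow> complex" where
  "rho_entry n U a b x y a' b' x' y' = (let p = 1 / (1 + sqrt n) in
     if a = b \<and> a' = b' then
       (if a = a' then (if x = x' \<and> y = y' then of_real ((1 - p) / (2 * (real n)\<^sup>2)) else 0)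
        else if x = y' \<and> y = x' then of_real ((1 - p) / (2 * (n * sqrt n))) * (if a = 0 then U $$ (x,y) else cnj (U $$ (y,x)))
        else 0)
     else if a \<noteq> b \<and> a' \<noteq> b' then
       (if x = y \<and> x' = y' then
          (if a = a' then (if x = x' then of_real (p / (2 * n)) else 0)
           else of_real (p / (2 * n)) * (if a = 0 then U $$ (x,x') else cnj (U $$ (x',x))))
        else 0)
     else 0)"

lemma diagm_index:
  "i < n \<Longrightarrow> j < n \<Longrightarrow> diagm n c $$ (i,j) = (if i = j then of_real (c i) else 0)"
  by (simp add: diagm_def)

lemma pair_index_inject:
  fixes b :: nat
  assumes "y < b" "y' < b"
  shows "x * b + y = x' * b + y' \<longleftrightarrow> x = x' \<and> y = y'"
proof
  assume eq: "x * b + y = x' * b + y'"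
  have "x = (x * b + y) div b" "y = (x * b + y) mod b" "x' = (x' * b + y') div b" "y' = (x' * b + y') mod b"
    using assms by auto
  with eq show "x = x' \<and> y = y'" by metis
qed simp

lemma pair_index_div_mod:
  fixes b :: nat
  assumes "y < b"
  shows "(x * b + y) div b = x" "(x * b + y) mod b = y"
  using assms by auto

text \<open>The values of the square roots enter the state here; all later computations use the
  closed form \<open>rho_entry\<close>.\<close>

lemma rho_block_index:
  assumes U: "flat_unitary n U" and bits: "a < 2" "b < 2" "a' < 2" "b' < 2"
    and xy: "x < n" "y < n" "x' < n" "y' < n"
  shows "rho_block n U (2*a+b) (2*a'+b') $$ (x*n+y, x'*n+y') = rho_entry n U a b x y a' b' x' y'"
proof -
  let ?r = "x*n+y" and ?s = "x'*n+y'"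
  have n: "0 < n" using xy by simp
  have rs: "?r < n*n" "?s < n*n" using xy by (simp_all add: pair_index_less)
  have dm: "?r div n = x" "?r mod n = y" "?s div n = x'" "?s mod n = y'" using xy by auto
  have sw: "?s = swap_idx n ?r \<longleftrightarrow> x = y' \<and> y = x'" "?r = swap_idx n ?s \<longleftrightarrow> x = y' \<and> y = x'"
    unfolding swap_idx_def dm using xy by (auto simp: pair_index_inject)
  have cj: "cadj (Xop n U) $$ (?r,?s) = cnj (Xop n U $$ (?s,?r))" "cadj (Yop n U) $$ (?r,?s) = cnj (Yop n U $$ (?s,?r))"
    using rs by (simp_all add: cadj_def Xop_def Yop_def)
  have X: "Xop n U $$ (?r,?s) = (if x = y' \<and> y = x' then U $$ (x,y) / of_real (n * sqrt n) else 0)"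
    "Xop n U $$ (?s,?r) = (if x = y' \<and> y = x' then U $$ (x',y') / of_real (n * sqrt n) else 0)"
    using Xop_index[OF rs, of U] Xop_index[OF rs(2,1), of U] unfolding sw dm by blast+
  have Y: "Yop n U $$ (?r,?s) = (if x = y \<and> x' = y' then U $$ (x,x') / of_nat n else 0)"
    "Yop n U $$ (?s,?r) = (if x' = y' \<and> x = y then U $$ (x',x) / of_nat n else 0)"
    using Yop_index[OF rs, of U] Yop_index[OF rs(2,1), of U] unfolding dm by blast+
  have dX: "diagm (n*n) (\<lambda>_. 1 / (real n)\<^sup>2) $$ (?r,?s) = (if x = x' \<and> y = y' then of_real (1 / (real n)\<^sup>2) else 0)"
    unfolding diagm_index[OF rs] pair_index_inject[OF xy(2,4)] ..
  have dY: "diagm (n*n) (\<lambda>r. if r div n = r mod n then 1 / real n else 0) $$ (?r,?s) =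
      (if x = x' \<and> y = y' then of_real (if x = y then 1 / real n else 0) else 0)"
    unfolding diagm_index[OF rs] pair_index_inject[OF xy(2,4)] dm ..
  have sm: "(k \<cdot>\<^sub>m M) $$ (?r,?s) = k * M $$ (?r,?s)" if "M \<in> carrier_mat (n*n) (n*n)" for k :: complex and M
    using that rs by simp
  have car: "Xop n U \<in> carrier_mat (n*n) (n*n)" "Yop n U \<in> carrier_mat (n*n) (n*n)"
    "cadj (Xop n U) \<in> carrier_mat (n*n) (n*n)" "cadj (Yop n U) \<in> carrier_mat (n*n) (n*n)"
    "diagm (n*n) c \<in> carrier_mat (n*n) (n*n)" for c
    by (simp_all add: Xop_def Yop_def cadj_def diagm_def)
  have z: "0\<^sub>m (n*n) (n*n) $$ (?r,?s) = (0::complex)" using rs by simp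
  define p where "p = 1 / (1 + sqrt n)"
  \<comment> \<open>The block labels stay variables, so that all index rewriting is finished before
    the bits are split into cases.\<close>
  have blk: "rho_block n U q q' $$ (?r,?s) =
     (if q = 0 \<and> q' = 0 then of_real ((1 - p) / 2) * (if x = x' \<and> y = y' then of_real (1 / (real n)\<^sup>2) else 0)
      else if q = 0 \<and> q' = 3 then of_real ((1 - p) / 2) * (if x = y' \<and> y = x' then U $$ (x,y) / of_real (n * sqrt n) else 0)
      else if q = 1 \<and> q' = 1 then of_real (p / 2) * (if x = x' \<and> y = y' then of_real (if x = y then 1 / real n else 0) else 0)
      else if q = 1 \<and> q' = 2 then of_real (p / 2) * (if x = y \<and> x' = y' then U $$ (x,x') / of_nat n else 0)
      else if q = 2 \<and> q' = 1 then of_real (p / 2) * cnj (if x' = y' \<and> x = y then U $$ (x',x) / of_nat n else 0)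
      else if q = 2 \<and> q' = 2 then of_real (p / 2) * (if x = x' \<and> y = y' then of_real (if x = y then 1 / real n else 0) else 0)
      else if q = 3 \<and> q' = 0 then of_real ((1 - p) / 2) * cnj (if x = y' \<and> y = x' then U $$ (x',y') / of_real (n * sqrt n) else 0)
      else if q = 3 \<and> q' = 3 then of_real ((1 - p) / 2) * (if x = x' \<and> y = y' then of_real (1 / (real n)\<^sup>2) else 0)
      else 0)" for q q'
    unfolding rho_block_def Let_def msqrt_Xop[OF U] msqrt_Yop[OF U] p_def[symmetric]
      if_distrib[of "\<lambda>M. M $$ (?r,?s)"] sm[OF car(1)] sm[OF car(2)] sm[OF car(3)] sm[OF car(4)] sm[OF car(5)] cj X Y dX dY z ..
  have e: "of_real ((1 - p) / 2) * of_real (1 / (real n)\<^sup>2) = (of_real ((1 - p) / (2 * (real n)\<^sup>2)) :: complex)"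
    "of_real ((1 - p) / 2) * (u / of_real (n * sqrt n)) = of_real ((1 - p) / (2 * (n * sqrt n))) * u"
    "of_real (p / 2) * of_real (1 / real n) = (of_real (p / (2 * n)) :: complex)"
    "of_real (p / 2) * (u / of_nat n) = of_real (p / (2 * n)) * u" for u :: complex
    by (simp_all add: field_simps)
  have cases: "a = 0 \<or> a = 1" "b = 0 \<or> b = 1" "a' = 0 \<or> a' = 1" "b' = 0 \<or> b' = 1" using bits by auto
  have cd: "cnj (u / of_real t) = cnj u / of_real t" "cnj (u / of_nat m) = cnj u / of_nat m" for u t m by simp_all
  show ?thesis
    unfolding blk rho_entry_def Let_def p_def[symmetric] if_distrib[of cnj] cd if_distrib[of "\<lambda>v. c * v" for c]
      if_distrib[of complex_of_real] e complex_cnj_zero mult_zero_right of_real_0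
    using cases by (elim disjE; hypsubst; auto)
qed

section \<open>Regrouped indices and invariance under the partial transpose\<close>

definition bitA :: "nat \<Rightarrow> nat \<Rightarrow> nat" where "bitA n i = i div (2*n) div n"
definition bitB :: "nat \<Rightarrow> nat \<Rightarrow> nat" where "bitB n i = i mod (2*n) div n"
definition locA :: "nat \<Rightarrow> nat \<Rightarrow> nat" where "locA n i = i div (2*n) mod n"
definition locB :: "nat \<Rightarrow> nat \<Rightarrow> nat" where "locB n i = i mod (2*n) mod n"

lemmas quad_defs = bitA_def bitB_def locA_def locB_def

lemma quad_less:
  assumes "i < (2*n)*(2*n)"
  shows "bitA n i < 2" "bitB n i < 2" "locA n i < n" "locB n i < n"
proof -
  have n: "0 < n" using assms by (cases n) auto
  have "i div (2*n) < 2*n" "i mod (2*n) < 2*n" using assms n by (auto simp: less_mult_imp_div_less)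
  then show "bitA n i < 2" "bitB n i < 2" "locA n i < n" "locB n i < n"
    using n by (auto simp: quad_defs less_mult_imp_div_less)
qed

lemma quad_eq:
  "i = (bitA n i * n + locA n i) * (2*n) + (bitB n i * n + locB n i)"
  by (simp only: quad_defs div_mult_mod_eq)

lemma sum_quad:
  fixes h :: "nat \<Rightarrow> nat \<Rightarrow> nat \<Rightarrow> nat \<Rightarrow> 'a::comm_monoid_add"
  assumes n: "0 < n"
  shows "(\<Sum>i<(2*n)*(2*n). h (bitA n i) (bitB n i) (locA n i) (locB n i)) =
    (\<Sum>x<n. \<Sum>y<n. h 0 0 x y + h 0 1 x y + (h 1 0 x y + h 1 1 x y))"
proof -
  have two: "(\<Sum>i<2*n. g (i div n) (i mod n)) = (\<Sum>x<n. g 0 x + g 1 x)" for g :: "nat \<Rightarrow> nat \<Rightarrow> 'a"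
    using sum_div_mod[OF n, of g 2] by (simp add: numeral_2_eq_2 sum.distrib)
  have "(\<Sum>i<(2*n)*(2*n). h (bitA n i) (bitB n i) (locA n i) (locB n i)) =
      (\<Sum>\<alpha><2*n. \<Sum>\<beta><2*n. h (\<alpha> div n) (\<beta> div n) (\<alpha> mod n) (\<beta> mod n))"
    unfolding quad_defs using n
    by (intro sum_div_mod[where h = "\<lambda>\<alpha> \<beta>. h (\<alpha> div n) (\<beta> div n) (\<alpha> mod n) (\<beta> mod n)"]) simp
  also have "\<dots> = (\<Sum>\<alpha><2*n. \<Sum>y<n. h (\<alpha> div n) 0 (\<alpha> mod n) y + h (\<alpha> div n) 1 (\<alpha> mod n) y)"
    by (intro sum.cong refl two[where g = "\<lambda>b y. h (\<alpha> div n) b (\<alpha> mod n) y" for \<alpha>])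
  also have "\<dots> = (\<Sum>x<n. (\<Sum>y<n. h 0 0 x y + h 0 1 x y) + (\<Sum>y<n. h 1 0 x y + h 1 1 x y))"
    by (rule two[where g = "\<lambda>a x. \<Sum>y<n. h a 0 x y + h a 1 x y"])
  finally show ?thesis by (simp add: sum.distrib)
qed

lemma rho_bip_carrier: "rho_bip n U \<in> carrier_mat ((2*n)*(2*n)) ((2*n)*(2*n))"
  by (simp add: rho_bip_def)

lemma rho_bip_index:
  assumes U: "flat_unitary n U" and i: "i < (2*n)*(2*n)" and j: "j < (2*n)*(2*n)"
  shows "rho_bip n U $$ (i,j) =
    rho_entry n U (bitA n i) (bitB n i) (locA n i) (locB n i) (bitA n j) (bitB n j) (locA n j) (locB n j)"
proof -
  have r: "reorder_idx n i = (2 * bitA n i + bitB n i) * (n*n) + (locA n i * n + locB n i)" for i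
    by (simp add: reorder_idx_def Let_def quad_defs)
  have lt: "reorder_idx n i < 4 * (n*n)" "reorder_idx n i div (n*n) = 2 * bitA n i + bitB n i"
    "reorder_idx n i mod (n*n) = locA n i * n + locB n i" if "i < (2*n)*(2*n)" for i
  proof -
    note q = quad_less[OF that]
    have l: "locA n i * n + locB n i < n * n" using q by (simp add: pair_index_less)
    have "2 * bitA n i + bitB n i < 4" using q by simp
    then show "reorder_idx n i < 4 * (n*n)" unfolding r using l by (rule pair_index_less)
    show "reorder_idx n i div (n*n) = 2 * bitA n i + bitB n i"
      "reorder_idx n i mod (n*n) = locA n i * n + locB n i" unfolding r
      by (rule pair_index_div_mod[OF l])+
  qed
  have "rho_bip n U $$ (i,j) = rho_ABAB n U $$ (reorder_idx n i, reorder_idx n j)"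
    using i j by (simp add: rho_bip_def)
  also have "\<dots> = rho_block n U (2 * bitA n i + bitB n i) (2 * bitA n j + bitB n j)
      $$ (locA n i * n + locB n i, locA n j * n + locB n j)"
    using lt[OF i] lt[OF j] by (simp add: rho_ABAB_def)
  also have "\<dots> = rho_entry n U (bitA n i) (bitB n i) (locA n i) (locB n i) (bitA n j) (bitB n j) (locA n j) (locB n j)"
    using quad_less[OF i] quad_less[OF j] by (intro rho_block_index[OF U])
  finally show ?thesis .
qed

text \<open>Exchanging b, y with b', y' carries the entry with u_xy of the X block at (00,11) to the
  one of the Y block at (01,10), and similarly for the adjoint blocks. The four diagonal blocks are
  diagonal matrices and stay fixed.\<close>

lemma rho_entry_swap:
  assumes n: "0 < n" and bits: "a < 2" "b < 2" "a' < 2" "b' < 2"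
  shows "rho_entry n U a b' x y' a' b x' y = rho_entry n U a b x y a' b' x' y'"
proof -
  \<comment> \<open>The coefficients of X and Y coincide because of the value of p: with r = sqrt n
    one has 1 - p = r / (1 + r).\<close>
  have c: "(1 - 1 / (1 + sqrt n)) / (2 * (n * sqrt n)) = 1 / (1 + sqrt n) / (2 * real n)"
  proof -
    obtain r where r: "r > 0" "sqrt n = r" "real n = r * r" using n that[of "sqrt n"] by simp
    have "1 - 1 / (1 + r) = r / (1 + r)" using r(1) by (simp add: field_simps)
    then show ?thesis unfolding r using r(1) by simp
  qed
  have cases: "a = 0 \<or> a = 1" "b = 0 \<or> b = 1" "a' = 0 \<or> a' = 1" "b' = 0 \<or> b' = 1" using bits by auto
  define e1 where "e1 = complex_of_real (1 / (1 + sqrt n) / (2 * real n))"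
  define e2 where "e2 = complex_of_real ((1 - 1 / (1 + sqrt n)) / (2 * (real n)\<^sup>2))"
  show ?thesis
    unfolding rho_entry_def Let_def c e1_def[symmetric] e2_def[symmetric] using cases
    by (elim disjE; hypsubst; simp only: if_True if_False simp_thms zero_neq_one one_neq_zero cong: if_cong;
        cases "x = y'"; cases "x' = y"; cases "x = y"; simp)
qed

lemma ptrans_rho_bip:
  assumes U: "flat_unitary n U" and n: "0 < n"
  shows "ptrans (2*n) (2*n) (rho_bip n U) = rho_bip n U"
proof (rule eq_matI)
  fix i j assume "i < dim_row (rho_bip n U)" "j < dim_col (rho_bip n U)"
  then have ij: "i < (2*n)*(2*n)" "j < (2*n)*(2*n)" by (simp_all add: rho_bip_def)
  define i' where "i' = i div (2*n) * (2*n) + j mod (2*n)"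
  define j' where "j' = j div (2*n) * (2*n) + i mod (2*n)"
  have i': "i' < (2*n)*(2*n)" and j': "j' < (2*n)*(2*n)"
    unfolding i'_def j'_def using less_mult_imp_div_less[OF ij(1)] less_mult_imp_div_less[OF ij(2)] n
    by (intro pair_index_less; simp)+
  have q: "bitA n i' = bitA n i" "locA n i' = locA n i" "bitB n i' = bitB n j" "locB n i' = locB n j"
    "bitA n j' = bitA n j" "locA n j' = locA n j" "bitB n j' = bitB n i" "locB n j' = locB n i"
    using n by (simp_all add: quad_defs i'_def j'_def)
  have "rho_bip n U $$ (i',j') = rho_bip n U $$ (i,j)"
    unfolding rho_bip_index[OF U ij] rho_bip_index[OF U i' j'] q
    using quad_less[OF ij(1)] quad_less[OF ij(2)] by (intro rho_entry_swap[OF n])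
  then show "ptrans (2*n) (2*n) (rho_bip n U) $$ (i,j) = rho_bip n U $$ (i,j)"
    using ij by (simp add: ptrans_def i'_def j'_def)
qed (simp_all add: ptrans_def rho_bip_def)

text \<open>On the bit value 1 the local indices are swapped, so that both basis vectors |00 xy> and
  |11 yx> get the key (x,y).\<close>

definition key :: "nat \<Rightarrow> nat \<Rightarrow> nat \<times> nat" where
  "key n i = (if bitA n i = 0 then (locA n i, locB n i) else (locB n i, locA n i))"

text \<open>With n = ds, f1 (x,y) is |00 xy> + sqrt n cnj(u_xy) |11 yx> and f2 z is
  (sum over x of u_xz |01 xx>) + |10 zz>, again in the order A, B, A', B'.\<close>

definition f1 :: "nat \<Rightarrow> complex mat \<Rightarrow> nat \<times> nat \<Rightarrow> nat \<Rightarrow> complex" where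
  "f1 n U s i = (if bitA n i = bitB n i \<and> key n i = s
     then (if bitA n i = 0 then 1 else of_real (sqrt n) * cnj (U $$ s)) else 0)"

definition f2 :: "nat \<Rightarrow> complex mat \<Rightarrow> nat \<Rightarrow> nat \<Rightarrow> complex" where
  "f2 n U z i = (if bitA n i \<noteq> bitB n i \<and> locA n i = locB n i
     then (if bitA n i = 0 then U $$ (locA n i, z) else if locA n i = z then 1 else 0) else 0)"

lemma key_in: "i < (2*n)*(2*n) \<Longrightarrow> key n i \<in> {..<n} \<times> {..<n}"
  using quad_less by (simp add: key_def)

text \<open>Flat entries become phases when multiplied by sqrt n; hence the two basis vectors in
  \<open>f1\<close> carry equal weight.\<close>

lemma flat_phase:
  assumes "flat_unitary n U" "s \<in> {..<n} \<times> {..<n}"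
  shows "cmod (of_real (sqrt n) * cnj (U $$ s)) = 1"
    "of_real (sqrt n) * cnj (U $$ s) * cnj (of_real (sqrt n) * cnj (U $$ s)) = 1"
proof -
  obtain x y where s: "s = (x,y)" "x < n" "y < n" using assms(2) by auto
  show 1: "cmod (of_real (sqrt n) * cnj (U $$ s)) = 1"
    using assms(1) s by (simp add: flat_unitary_def norm_mult)
  show "of_real (sqrt n) * cnj (U $$ s) * cnj (of_real (sqrt n) * cnj (U $$ s)) = 1"
    unfolding complex_norm_square[symmetric] 1 by simp
qed

text \<open>Different keys have disjoint supports; for equal keys |00 xy> and |11 yx> contribute one
  each.\<close>

lemma ip_f1:
  assumes U: "flat_unitary n U" and s: "s \<in> {..<n} \<times> {..<n}"
  shows "ip ((2*n)*(2*n)) (f1 n U s) (f1 n U t) = (if s = t then 2 else 0)"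
proof (cases "s = t")
  case True
  obtain x0 y0 where s0: "s = (x0,y0)" "x0 < n" "y0 < n" using s by auto
  then have n: "0 < n" by simp
  let ?h = "\<lambda>a b x y. (if a = (b::nat) \<and> (if a = 0 then (x,y) else (y,x)) = s then 1 else 0) :: complex"
  have "ip ((2*n)*(2*n)) (f1 n U s) (f1 n U t) = (\<Sum>i<(2*n)*(2*n). ?h (bitA n i) (bitB n i) (locA n i) (locB n i))"
    unfolding ip_def True[symmetric]
    using flat_phase(2)[OF U s] by (intro sum.cong refl) (auto simp: f1_def key_def mult.commute)
  also have "\<dots> = (\<Sum>x<n. \<Sum>y<n. ?h 0 0 x y + ?h 0 1 x y + (?h 1 0 x y + ?h 1 1 x y))"
    by (rule sum_quad[OF n])
  also have "\<dots> = (\<Sum>x<n. \<Sum>y<n. (if x = x0 then if y = y0 then 1 else 0 else 0) + (if x = y0 then if y = x0 then 1 else 0 else 0))"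
    by (intro sum.cong refl) (auto simp: s0(1))
  also have "\<dots> = (\<Sum>x<n. (if x = x0 then 1 else 0) + (if x = y0 then 1 else 0))"
    using s0 by (intro sum.cong refl) (simp add: sum.distrib)
  also have "\<dots> = 2" using s0 by (simp add: sum.distrib)
  finally show ?thesis using True by simp
next
  case False
  then show ?thesis by (auto simp: ip_def f1_def intro!: sum.neutral)
qed

text \<open>One comes from the unit column z of U in the sector |01>, the other from |10
  zz>.\<close>

lemma ip_f2:
  assumes U: "flat_unitary n U" and z: "z < n"
  shows "ip ((2*n)*(2*n)) (f2 n U z) (f2 n U z) = 2"
proof -
  have n: "0 < n" using z by simp
  let ?h = "\<lambda>a b x y. (if a \<noteq> b \<and> x = y then (if a = 0 then cnj (U $$ (x,z)) * U $$ (x,z) else if x = z then 1 else 0) else 0)"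
  have "ip ((2*n)*(2*n)) (f2 n U z) (f2 n U z) =
      (\<Sum>i<(2*n)*(2*n). ?h (bitA n i) (bitB n i) (locA n i) (locB n i))"
    unfolding ip_def by (intro sum.cong refl) (auto simp: f2_def)
  also have "\<dots> = (\<Sum>x<n. \<Sum>y<n. ?h 0 (1::nat) x y + ?h 1 (0::nat) x y)"
    unfolding sum_quad[OF n, of ?h] by (intro sum.cong refl) simp
  also have "\<dots> = (\<Sum>x<n. cnj (U $$ (x,z)) * U $$ (x,z) + (if x = z then 1 else 0))"
    by (intro sum.cong refl) (simp add: sum.distrib)
  also have "\<dots> = 2" using z by (simp add: sum.distrib flat_unitary_rows(2)[OF U z z])
  finally show ?thesis .
qed

text \<open>The key bits agree on the support of one vector and differ on that of the other.\<close>

lemma ip_f2_f1: "ip m (f2 n U z) (f1 n U s) = 0"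
  by (auto simp: ip_def f1_def f2_def intro!: sum.neutral)

definition rho_index :: "nat \<Rightarrow> (nat \<times> nat + nat) set" where
  "rho_index n = ({..<n} \<times> {..<n}) <+> {..<n}"

definition rho_weight :: "nat \<Rightarrow> nat \<times> nat + nat \<Rightarrow> real" where
  "rho_weight n = case_sum (\<lambda>_. (1 - 1 / (1 + sqrt n)) / (2 * (real n)\<^sup>2)) (\<lambda>_. 1 / (1 + sqrt n) / (2 * n))"

definition rho_vec :: "nat \<Rightarrow> complex mat \<Rightarrow> nat \<times> nat + nat \<Rightarrow> nat \<Rightarrow> complex" where
  "rho_vec n U = case_sum (f1 n U) (f2 n U)"

lemma sum_rho_index: "(\<Sum>t\<in>rho_index n. h t) = (\<Sum>s\<in>{..<n} \<times> {..<n}. h (Inl s)) + (\<Sum>z<n. h (Inr z))"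
  unfolding rho_index_def by (simp add: sum.Plus)

text \<open>For equal bits, the factor sqrt n u_xy in a cross term of \<open>f1\<close> turns the
  weight with 1/n^2 into the coefficient of X with 1/(n sqrt n). For different bits, orthonormal
  rows of U collapse the sum over z to the diagonal within 01, and the single vector |10 zz> picks
  out u_xz between 01 and 10.\<close>

lemma rho_bip_eq_gram:
  assumes U: "flat_unitary n U" and n: "0 < n"
  shows "rho_bip n U = gram ((2*n)*(2*n)) (rho_index n) (rho_weight n) (rho_vec n U)"
proof (rule eq_matI)
  let ?N = "(2*n)*(2*n)"
  fix i j assume "i < dim_row (gram ?N (rho_index n) (rho_weight n) (rho_vec n U))"
    "j < dim_col (gram ?N (rho_index n) (rho_weight n) (rho_vec n U))"
  then have ij: "i < ?N" "j < ?N" by simp_all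
  define c1 where "c1 = (1 - 1 / (1 + sqrt n)) / (2 * (real n)\<^sup>2)"
  define c2 where "c2 = 1 / (1 + sqrt n) / (2 * real n)"
  define ph where "ph k s = (if k = (0::nat) then 1 else of_real (sqrt n) * cnj (U $$ s))" for k s
  note li = quad_less[OF ij(1)] and lj = quad_less[OF ij(2)]
  have S1: "(\<Sum>s\<in>{..<n} \<times> {..<n}. f1 n U s i * cnj (f1 n U s j)) =
      (if bitA n i = bitB n i \<and> bitA n j = bitB n j \<and> key n i = key n j
       then ph (bitA n i) (key n i) * cnj (ph (bitA n j) (key n i)) else 0)" (is "?L = ?R")
  proof -
    have "?L = (\<Sum>s\<in>{..<n} \<times> {..<n}. if s = key n i then ?R else 0)"
      by (intro sum.cong refl) (auto simp: f1_def ph_def)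
    also have "\<dots> = ?R" using key_in[OF ij(1)] by (subst sum.delta) auto
    finally show ?thesis .
  qed
  have S2: "(\<Sum>z<n. f2 n U z i * cnj (f2 n U z j)) =
      (if bitA n i \<noteq> bitB n i \<and> bitA n j \<noteq> bitB n j \<and> locA n i = locB n i \<and> locA n j = locB n j
       then (if bitA n i = bitA n j then (if locA n i = locA n j then 1 else 0)
         else if bitA n i = 0 then U $$ (locA n i, locA n j) else cnj (U $$ (locA n j, locA n i))) else 0)"
    (is "?L = ?R")
  proof (cases "bitA n i \<noteq> bitB n i \<and> bitA n j \<noteq> bitB n j \<and> locA n i = locB n i \<and> locA n j = locB n j")
    case False
    have "f2 n U z i * cnj (f2 n U z j) = 0" for z
      using False unfolding f2_def by (simp only: de_Morgan_conj) (elim disjE; simp)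
    then have "?L = 0" by simp
    then show ?thesis using False by (simp only: if_False)
  next
    case True
    have ai: "bitA n i = 0 \<or> bitA n i = 1" and aj: "bitA n j = 0 \<or> bitA n j = 1" using li lj by auto
    have L: "?L = (\<Sum>z<n. (if bitA n i = 0 then U $$ (locA n i, z) else if locA n i = z then 1 else 0) *
        cnj (if bitA n j = 0 then U $$ (locA n j, z) else if locA n j = z then 1 else 0))"
      using True by (simp add: f2_def)
    from ai aj consider "bitA n i = 0" "bitA n j = 0" | "bitA n i = 0" "bitA n j = 1"
      | "bitA n i = 1" "bitA n j = 0" | "bitA n i = 1" "bitA n j = 1" by metis
    then show ?thesis
    proof cases
      case 1
      then show ?thesis using True flat_unitary_rows(1)[OF U li(3) lj(3)] unfolding L by simp
    next
      case 2
      then have "?L = (\<Sum>z<n. if locA n j = z then U $$ (locA n i, z) else 0)"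
        unfolding L by (intro sum.cong refl) simp
      then show ?thesis using True 2 lj(3) by simp
    next
      case 3
      then have "?L = (\<Sum>z<n. if locA n i = z then cnj (U $$ (locA n j, z)) else 0)"
        unfolding L by (intro sum.cong refl) simp
      then show ?thesis using True 3 li(3) by simp
    next
      case 4
      then have "?L = (\<Sum>z<n. if locA n i = z then (if locA n i = locA n j then 1 else 0) else 0)"
        unfolding L by (intro sum.cong refl) auto
      then show ?thesis using True 4 li(3) by simp
    qed
  qed
  have "gram ?N (rho_index n) (rho_weight n) (rho_vec n U) $$ (i,j) =
      of_real c1 * (\<Sum>s\<in>{..<n} \<times> {..<n}. f1 n U s i * cnj (f1 n U s j)) + of_real c2 * (\<Sum>z<n. f2 n U z i * cnj (f2 n U z j))"
    unfolding gram_index[OF ij] sum_rho_index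
    by (simp add: rho_weight_def rho_vec_def c1_def c2_def sum_distrib_left mult.assoc)
  also have "\<dots> = rho_entry n U (bitA n i) (bitB n i) (locA n i) (locB n i) (bitA n j) (bitB n j) (locA n j) (locB n j)"
  proof -
    have sq: "complex_of_real c1 * (of_real (sqrt n)) = of_real ((1 - 1 / (1 + sqrt n)) / (2 * (n * sqrt n)))"
    proof -
      obtain r where r: "r > 0" "sqrt n = r" "real n = r * r"
        using n that[of "sqrt n"] by simp
      have "c1 * sqrt n = (1 - 1 / (1 + sqrt n)) / (2 * (n * sqrt n))"
        unfolding c1_def r using r(1) by (simp add: power2_eq_square)
      then show ?thesis by (metis of_real_mult)
    qed
    have cases: "bitA n i = 0 \<or> bitA n i = 1" "bitB n i = 0 \<or> bitB n i = 1"
      "bitA n j = 0 \<or> bitA n j = 1" "bitB n j = 0 \<or> bitB n j = 1" using li lj by auto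
    have phn: "ph 1 (key n i) * cnj (ph 1 (key n i)) = 1"
      using flat_phase(2)[OF U key_in[OF ij(1)]] by (simp add: ph_def)
    have ph1: "of_real c1 * (ph 1 s) = of_real ((1 - 1 / (1 + sqrt n)) / (2 * (n * sqrt n))) * cnj (U $$ s)"
      "of_real c1 * cnj (ph 1 s) = of_real ((1 - 1 / (1 + sqrt n)) / (2 * (n * sqrt n))) * U $$ s" for s
      unfolding sq[symmetric] by (simp_all add: ph_def)
    have ph0: "ph 0 s = 1" for s by (simp add: ph_def)
    show ?thesis
      unfolding S1 S2 rho_entry_def Let_def c1_def[symmetric] c2_def[symmetric]
      using cases phn
      by (elim disjE) (auto simp: ph1[unfolded One_nat_def] ph0 key_def)
  qed
  finally show "rho_bip n U $$ (i,j) = gram ?N (rho_index n) (rho_weight n) (rho_vec n U) $$ (i,j)"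
    by (simp add: rho_bip_index[OF U ij])
qed (simp_all add: rho_bip_def)

lemma rho_weight_nonneg: "0 \<le> rho_weight n t"
proof -
  have "0 < 1 + sqrt n" by (intro add_pos_nonneg) simp_all
  then have "1 / (1 + sqrt n) \<le> 1" by (simp add: divide_le_eq_1_pos)
  then show ?thesis by (cases t) (simp_all add: rho_weight_def del: divide_le_eq_1)
qed

text \<open>All terms have squared norm 2: the n^2 of the first kind contribute 1 - p in total, the
  n of the second kind p.\<close>

lemma mtrace_rho_bip:
  assumes U: "flat_unitary n U" and n: "0 < n"
  shows "mtrace (rho_bip n U) = 1"
proof -
  define p where "p = 1 / (1 + sqrt n)"
  have "of_real (rho_weight n (Inl s)) * ip ((2*n)*(2*n)) (rho_vec n U (Inl s)) (rho_vec n U (Inl s)) =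
      of_real ((1 - p) / (2 * (real n)\<^sup>2)) * 2" if "s \<in> {..<n} \<times> {..<n}" for s
    unfolding rho_vec_def sum.case ip_f1[OF U that] by (simp add: rho_weight_def p_def)
  moreover have "of_real (rho_weight n (Inr z)) * ip ((2*n)*(2*n)) (rho_vec n U (Inr z)) (rho_vec n U (Inr z)) =
      of_real (p / (2 * n)) * 2" if "z \<in> {..<n}" for z
    unfolding rho_vec_def sum.case ip_f2[OF U that[unfolded lessThan_iff]] by (simp add: rho_weight_def p_def)
  ultimately have "mtrace (rho_bip n U) = (\<Sum>s\<in>{..<n} \<times> {..<n}. of_real ((1 - p) / (2 * (real n)\<^sup>2)) * 2) + (\<Sum>z<n. of_real (p / (2 * n)) * 2)"
    unfolding rho_bip_eq_gram[OF U n] mtrace_gram sum_rho_index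
    by (intro arg_cong2[of _ _ _ _ "(+)"] sum.cong refl)
  also have "\<dots> = of_real (real (n*n) * ((1 - p) / (2 * (real n)\<^sup>2) * 2) + n * (p / (2 * n) * 2))"
    by simp
  also have "real (n*n) * ((1 - p) / (2 * (real n)\<^sup>2) * 2) + n * (p / (2 * n) * 2) = 1"
    using n by (simp add: power2_eq_square field_simps)
  finally show ?thesis by simp
qed

definition gvec :: "nat \<Rightarrow> complex mat \<Rightarrow> nat \<times> nat \<Rightarrow> nat \<Rightarrow> complex" where
  "gvec n U s i = f1 n U s i / of_real (sqrt 2)"

lemma ip_gvec: "ip m v (gvec n U s) = ip m v (f1 n U s) / of_real (sqrt 2)"
  by (simp add: ip_def gvec_def sum_divide_distrib)

lemma orthonormal_fam_gvec:
  assumes U: "flat_unitary n U"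
  shows "orthonormal_fam ((2*n)*(2*n)) ({..<n} \<times> {..<n}) (gvec n U)"
proof -
  have "ip ((2*n)*(2*n)) (gvec n U s) (gvec n U t) = (if s = t then 1 else 0)" if s: "s \<in> {..<n} \<times> {..<n}" for s t
  proof -
    have "ip ((2*n)*(2*n)) (gvec n U s) (f1 n U t) = cnj (ip ((2*n)*(2*n)) (f1 n U t) (f1 n U s) / of_real (sqrt 2))"
      by (metis ip_cnj ip_gvec)
    also have "\<dots> = ip ((2*n)*(2*n)) (f1 n U s) (f1 n U t) / of_real (sqrt 2)" by (simp add: ip_cnj)
    finally have "ip ((2*n)*(2*n)) (gvec n U s) (gvec n U t) = (if s = t then 2 else 0) / (of_real (sqrt 2) * of_real (sqrt 2))"
      unfolding ip_gvec ip_f1[OF U s] by simp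
    also have "\<dots> = (if s = t then 1 else 0)" by (simp flip: of_real_mult)
    finally show ?thesis .
  qed
  then show ?thesis unfolding orthonormal_fam_def by blast
qed

text \<open>\<open>gvec n U s\<close> meets only the rank-one term of the same s, with squared
  overlap (2 / sqrt 2)^2 = 2; each of the n^2 keys thus yields (1 - p)/n^2.\<close>

lemma sum_qf_rho_bip:
  assumes U: "flat_unitary n U" and n: "0 < n"
  shows "(\<Sum>s\<in>{..<n} \<times> {..<n}. qf ((2*n)*(2*n)) (rho_bip n U) (gvec n U s)) = of_real (1 - 1 / (1 + sqrt n))"
proof -
  define p where "p = 1 / (1 + sqrt n)"
  have gen: "a / (2 * c) * 2 = a / c" for a c :: real by simp
  have "qf ((2*n)*(2*n)) (rho_bip n U) (gvec n U s) = of_real ((1 - p) / (real n)\<^sup>2)" if s: "s \<in> {..<n} \<times> {..<n}" for s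
  proof -
    have "(\<Sum>t\<in>rho_index n. rho_weight n t * (cmod (ip ((2*n)*(2*n)) (rho_vec n U t) (gvec n U s)))\<^sup>2) =
        (\<Sum>t\<in>{..<n} \<times> {..<n}. if t = s then (1 - p) / (2 * (real n)\<^sup>2) * 2 else 0)"
    proof -
      have "rho_weight n (Inl t) * (cmod (ip ((2*n)*(2*n)) (rho_vec n U (Inl t)) (gvec n U s)))\<^sup>2 =
          (if t = s then (1 - p) / (2 * (real n)\<^sup>2) * 2 else 0)" if "t \<in> {..<n} \<times> {..<n}" for t
        unfolding rho_vec_def sum.case ip_gvec ip_f1[OF U that]
        by (simp add: rho_weight_def p_def norm_divide power_divide diff_divide_distrib)
      moreover have "rho_weight n (Inr z) * (cmod (ip ((2*n)*(2*n)) (rho_vec n U (Inr z)) (gvec n U s)))\<^sup>2 = 0" for z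
        unfolding rho_vec_def sum.case ip_gvec ip_f2_f1 by simp
      ultimately show ?thesis unfolding sum_rho_index by simp
    qed
    also have "\<dots> = (1 - p) / (2 * (real n)\<^sup>2) * 2" using s by (subst sum.delta) auto
    also have "\<dots> = (1 - p) / (real n)\<^sup>2" by (rule gen)
    finally show ?thesis unfolding rho_bip_eq_gram[OF U n] qf_gram by (rule arg_cong)
  qed
  then have "(\<Sum>s\<in>{..<n} \<times> {..<n}. qf ((2*n)*(2*n)) (rho_bip n U) (gvec n U s)) = of_nat (n*n) * of_real ((1 - p) / (real n)\<^sup>2)"
    by simp
  also have "\<dots> = of_real (1 - p)" using n by (simp add: power2_eq_square)
  finally show ?thesis by (simp add: p_def)
qed

lemma cmod_gvec:
  assumes U: "flat_unitary n U" and i: "i < (2*n)*(2*n)"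
  shows "cmod (gvec n U s i) = (if i div (2*n) div n = i mod (2*n) div n \<and> key n i = s then 1 / sqrt 2 else 0)"
  using flat_phase(1)[OF U key_in[OF i]]
  by (auto simp: gvec_def f1_def norm_divide bitA_def bitB_def)

text \<open>The key lists the local indices in an order that depends on the bit, so bit and key
  together recover all four coordinates.\<close>

lemma key_inject:
  assumes "i < (2*n)*(2*n)" "j < (2*n)*(2*n)"
    "i div (2*n) div n = i mod (2*n) div n" "j div (2*n) div n = j mod (2*n) div n"
    "i div (2*n) div n = j div (2*n) div n" "key n i = key n j"
  shows "i = j"
proof -
  have "bitA n i = bitA n j" "bitB n i = bitB n j" using assms(3-5) by (simp_all add: bitA_def bitB_def)
  moreover have "locA n i = locA n j" "locB n i = locB n j"
    using assms(6) \<open>bitA n i = bitA n j\<close> by (auto simp: key_def split: if_splits)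
  ultimately show ?thesis using quad_eq[of i n] quad_eq[of j n] by simp
qed

section \<open>Distance to the separable states\<close>

text \<open>Bounding the infimum in \<open>dist_SEP\<close> from below requires a nonempty set; the
  pure product state |00><00| is a member.\<close>

lemma SEP_states_nonempty:
  assumes "0 < d"
  shows "SEP_states d d \<noteq> {}"
proof -
  define E where "E = diagm d (\<lambda>i. if i = 0 then 1 else 0)"
  have "mtrace E = (\<Sum>i<d. if i = 0 then 1 else 0)"
    unfolding mtrace_def by (intro sum.cong) (auto simp: E_def diagm_def)
  then have "is_state d E" using assms by (simp add: is_state_def E_def psd_diagm)
  then have "mat (d*d) (d*d) (\<lambda>(i,j). \<Sum>t<1::nat. complex_of_real 1 * kron E E $$ (i,j)) \<in> SEP_states d d"
    unfolding SEP_states_def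
    by (intro CollectI exI[of _ 1] exI[of _ "\<lambda>_. 1"] exI[of _ "\<lambda>_. E"]) auto
  then show ?thesis by blast
qed

text \<open>Both states have trace one, so the trace term in the lower bound for the trace norm
  vanishes on their difference.\<close>

lemma dist_SEP_ge:
  assumes d: "0 < d" and h: "herm (d*d) \<rho>" and tr: "mtrace \<rho> = 1" and G: "orthonormal_fam (d*d) T G"
    and lo: "x \<le> (\<Sum>t\<in>T. Re (qf (d*d) \<rho> (G t)))"
    and up: "\<And>\<sigma>. \<sigma> \<in> SEP_states d d \<Longrightarrow> (\<Sum>t\<in>T. Re (qf (d*d) \<sigma> (G t))) \<le> y"
  shows "2 * (x - y) \<le> dist_SEP d d \<rho>"
  unfolding dist_SEP_def
proof (rule cInf_greatest)
  show "{trace_norm (\<rho> - \<sigma>) |\<sigma>. \<sigma> \<in> SEP_states d d} \<noteq> {}"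
    using SEP_states_nonempty[OF d] by blast
  fix r assume "r \<in> {trace_norm (\<rho> - \<sigma>) |\<sigma>. \<sigma> \<in> SEP_states d d}"
  then obtain \<sigma> where s: "\<sigma> \<in> SEP_states d d" and r: "r = trace_norm (\<rho> - \<sigma>)" by blast
  have hs: "herm (d*d) \<sigma>" by (rule herm_separable[OF s])
  have c: "\<rho> \<in> carrier_mat (d*d) (d*d)" "\<sigma> \<in> carrier_mat (d*d) (d*d)"
    using h hs by (simp_all add: herm_def)
  have hd: "herm (d*d) (\<rho> - \<sigma>)"
    unfolding herm_def
  proof (intro conjI allI impI)
    show "\<rho> - \<sigma> \<in> carrier_mat (d*d) (d*d)" by (rule minus_carrier_mat[OF c(2)])
    fix i j assume ij: "i < d*d" "j < d*d"
    have "\<rho> $$ (i,j) = cnj (\<rho> $$ (j,i))" "\<sigma> $$ (i,j) = cnj (\<sigma> $$ (j,i))"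
      using h hs ij unfolding herm_def by blast+
    then show "(\<rho> - \<sigma>) $$ (i,j) = cnj ((\<rho> - \<sigma>) $$ (j,i))" using c ij by simp
  qed
  have q: "qf (d*d) (\<rho> - \<sigma>) v = qf (d*d) \<rho> v - qf (d*d) \<sigma> v" for v
    unfolding qf_def sum_subtractf[symmetric] using c
    by (intro sum.cong refl) (simp add: algebra_simps)
  have t: "mtrace (\<rho> - \<sigma>) = 0"
  proof -
    have "mtrace (\<rho> - \<sigma>) = mtrace \<rho> - mtrace \<sigma>"
      using c unfolding mtrace_def by (simp add: sum_subtractf)
    then show ?thesis using tr mtrace_separable[OF s d] by simp
  qed
  have "2 * (x - y) \<le> 2 * (\<Sum>t\<in>T. Re (qf (d*d) (\<rho> - \<sigma>) (G t)))"
    using lo up[OF s] by (simp add: q sum_subtractf)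
  also have "\<dots> \<le> trace_norm (\<rho> - \<sigma>)" using trace_norm_ge[OF hd G] t by simp
  finally show "2 * (x - y) \<le> r" by (simp add: r)
qed

text \<open>Invariance under the partial transpose reduces the PPT condition to positivity of the
  state itself.\<close>

lemma is_PPT_rho_tensor:
  assumes U: "flat_unitary n U" and n: "0 < n"
  shows "is_PPT ((2*n)^l) ((2*n)^l) (bip_tensor_pow (2*n) l (rho_bip n U))"
proof -
  let ?D = "2*n" let ?R = "bip_tensor_pow (2*n) l (rho_bip n U)"
  have D: "0 < ?D" using n by simp
  have "?R = gram (?D^l * ?D^l) ({..<l} \<rightarrow>\<^sub>E rho_index n) (\<lambda>\<sigma>. \<Prod>k<l. rho_weight n (\<sigma> k)) (tens ?D l (rho_vec n U))"
    unfolding rho_bip_eq_gram[OF U n] by (rule bip_tensor_pow_gram[OF D]) (simp add: rho_index_def)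
  then have psd: "psd (?D^l * ?D^l) ?R"
    by (simp only:) (intro psd_gram prod_nonneg rho_weight_nonneg)
  have "mtrace ?R = mtrace (rho_bip n U) ^ l" by (rule mtrace_bip_tensor_pow[OF D rho_bip_carrier])
  then have "mtrace ?R = 1" by (simp add: mtrace_rho_bip[OF U n])
  moreover have "ptrans (?D^l) (?D^l) ?R = ?R"
    by (simp only: ptrans_bip_tensor_pow[OF D] ptrans_rho_bip[OF U n])
  ultimately show ?thesis using psd by (simp add: is_PPT_def is_state_def)
qed

lemma dist_SEP_rho_tensor:
  assumes U: "flat_unitary n U" and n: "0 < n"
  shows "2 * ((1 - 1 / (1 + sqrt n)) ^ l - (1/2) ^ l) \<le>
    dist_SEP ((2*n)^l) ((2*n)^l) (bip_tensor_pow (2*n) l (rho_bip n U))"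
proof (rule dist_SEP_ge)
  let ?D = "2*n" let ?R = "bip_tensor_pow (2*n) l (rho_bip n U)"
  let ?S = "{..<n} \<times> {..<n}"
  have D: "0 < ?D" using n by simp
  show "0 < ?D^l" using n by simp
  have st: "is_state (?D^l * ?D^l) ?R" using is_PPT_rho_tensor[OF U n] by (simp add: is_PPT_def)
  then show "herm (?D^l * ?D^l) ?R" "mtrace ?R = 1" by (simp_all add: is_state_def psd_imp_herm)
  show "orthonormal_fam (?D^l * ?D^l) ({..<l} \<rightarrow>\<^sub>E ?S) (tens ?D l (gvec n U))"
    by (rule orthonormal_fam_tens[OF D orthonormal_fam_gvec[OF U]])
  have "(\<Sum>\<sigma>\<in>{..<l} \<rightarrow>\<^sub>E ?S. qf (?D^l * ?D^l) ?R (tens ?D l (gvec n U) \<sigma>)) =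
      (\<Sum>s\<in>?S. qf (?D*?D) (rho_bip n U) (gvec n U s)) ^ l"
    by (rule sum_qf_bip_tensor_pow[OF D]) simp
  also have "\<dots> = of_real ((1 - 1 / (1 + sqrt n)) ^ l)"
    unfolding sum_qf_rho_bip[OF U n] of_real_power ..
  finally have "Re (\<Sum>\<sigma>\<in>{..<l} \<rightarrow>\<^sub>E ?S. qf (?D^l * ?D^l) ?R (tens ?D l (gvec n U) \<sigma>)) = (1 - 1 / (1 + sqrt n)) ^ l"
    by (simp only: Re_complex_of_real)
  then show "(1 - 1 / (1 + sqrt n)) ^ l \<le> (\<Sum>\<sigma>\<in>{..<l} \<rightarrow>\<^sub>E ?S. Re (qf (?D^l * ?D^l) ?R (tens ?D l (gvec n U) \<sigma>)))"
    by simp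
  show "(\<Sum>\<sigma>\<in>{..<l} \<rightarrow>\<^sub>E ?S. Re (qf (?D^l * ?D^l) \<rho> (tens ?D l (gvec n U) \<sigma>))) \<le> (1/2) ^ l"
    if "\<rho> \<in> SEP_states (?D^l) (?D^l)" for \<rho>
  \<comment> \<open>An index \<alpha> of one party's space, C^2 tensor C^n, carries its key bit in
    \<open>\<alpha> div n\<close>.\<close>
  proof (rule separable_overlap[OF D _ _ _ that, where bt = "\<lambda>\<alpha>. \<alpha> div n" and key = "key n"])
    show "cmod (gvec n U s m) = (if m div (2*n) div n = m mod (2*n) div n \<and> key n m = s then 1 / sqrt 2 else 0)"
      if "m < 2*n*(2*n)" for s m by (rule cmod_gvec[OF U that])
  qed (simp, rule key_inject)
qed

text \<open>The discrete Fourier matrix works; orthogonality of its rows is a geometric sum over a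
  root of unity other than 1.\<close>

lemma flat_unitary_exists:
  assumes n: "0 < n"
  shows "\<exists>U. flat_unitary n U"
proof -
  define z where "z k = cis (2 * pi * real k / real n)" for k :: nat
  define U where "U = mat n n (\<lambda>(i,j). z i ^ j / of_real (sqrt n))"
  have zn: "z k ^ n = 1" for k
  proof -
    have "z k ^ n = cis (2 * pi * real k)" using n by (simp add: z_def Complex.DeMoivre)
    also have "\<dots> = 1" by (rule cis_multiple_2pi) simp
    finally show ?thesis .
  qed
  have inj: "z i = z j \<longleftrightarrow> i = j" if "i < n" "j < n" for i j
    using bij_betw_roots_unity[OF n] that unfolding bij_betw_def z_def by (auto dest: inj_onD)
  have norm: "cmod (z k) = 1" for k by (simp add: z_def)
  have zz: "z k * cnj (z k) = 1" for k
    unfolding complex_norm_square[symmetric] norm by simp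
  \<comment> \<open>Symmetry of the Fourier matrix reduces its columns to its rows.\<close>
  have sym: "z i ^ j = z j ^ i" for i j
    by (simp add: z_def Complex.DeMoivre mult_ac)
  have orth: "(\<Sum>k<n. z i ^ k * cnj (z j ^ k)) = (if i = j then of_nat n else 0)" if "i < n" "j < n" for i j
  proof (cases "i = j")
    case True
    have "z j ^ k * cnj (z j ^ k) = 1" for k
      using zz[of j] by (simp add: power_mult_distrib[symmetric])
    then show ?thesis using True by simp
  next
    case False
    have ne: "z i * cnj (z j) \<noteq> 1"
    proof
      assume "z i * cnj (z j) = 1"
      then have "z i * (cnj (z j) * z j) = z j" by (simp add: mult.assoc[symmetric])
      then show False using zz[of j] inj[OF that] False by (simp add: mult.commute)
    qed
    have "(\<Sum>k<n. z i ^ k * cnj (z j ^ k)) = (\<Sum>k<n. (z i * cnj (z j)) ^ k)"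
      by (simp add: power_mult_distrib)
    also have "\<dots> = ((z i * cnj (z j)) ^ n - 1) / (z i * cnj (z j) - 1)"
      by (rule geometric_sum[OF ne])
    also have "(z i * cnj (z j)) ^ n = 1"
      using zn[of i] arg_cong[OF zn[of j], of cnj] by (simp add: power_mult_distrib)
    finally show ?thesis using False by simp
  qed
  have U: "U \<in> carrier_mat n n" by (simp add: U_def)
  have sq: "complex_of_real (sqrt n) * complex_of_real (sqrt n) = of_nat n"
    by (simp flip: of_real_mult)
  have "U * cadj U = 1\<^sub>m n"
  proof (rule eq_matI)
    fix i j assume "i < dim_row (1\<^sub>m n :: complex mat)" "j < dim_col (1\<^sub>m n :: complex mat)"
    then have ij: "i < n" "j < n" by simp_all
    have "(U * cadj U) $$ (i,j) = (\<Sum>k<n. z i ^ k * cnj (z j ^ k)) / of_nat n"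
      unfolding mult_cadj_index(1)[OF U ij] sum_divide_distrib sq[symmetric]
      using ij by (intro sum.cong refl) (simp add: U_def)
    then show "(U * cadj U) $$ (i,j) = 1\<^sub>m n $$ (i,j)" using orth[OF ij] ij n by simp
  qed (simp_all add: U_def cadj_def)
  moreover have "cadj U * U = 1\<^sub>m n"
  proof (rule eq_matI)
    fix i j assume "i < dim_row (1\<^sub>m n :: complex mat)" "j < dim_col (1\<^sub>m n :: complex mat)"
    then have ij: "i < n" "j < n" by simp_all
    have "(cadj U * U) $$ (i,j) = (\<Sum>k<n. z j ^ k * cnj (z i ^ k)) / of_nat n"
      unfolding mult_cadj_index(2)[OF U ij] sum_divide_distrib sq[symmetric]
      using ij by (intro sum.cong refl) (simp add: U_def sym[of _ i] sym[of _ j])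
    then show "(cadj U * U) $$ (i,j) = 1\<^sub>m n $$ (i,j)" using orth[OF ij(2,1)] ij n by simp
  qed (simp_all add: U_def cadj_def)
  moreover have "\<forall>i<n. \<forall>j<n. cmod (U $$ (i,j)) = 1 / sqrt n"
    by (auto simp: U_def norm_divide norm_power norm)
  ultimately have "flat_unitary n U" using U by (simp add: flat_unitary_def)
  then show ?thesis by blast
qed

text \<open>The loss is split evenly: l makes 2^(-l) at most epsilon/4, and sqrt n >= 4 l / epsilon
  - 1 makes l p at most epsilon/4.\<close>

lemma parameter_bounds:
  fixes \<epsilon> :: real
  assumes e: "0 < \<epsilon>" "\<epsilon> < 2"
  defines "L \<equiv> log 2 (4 / \<epsilon>)"
  defines "l \<equiv> nat \<lceil>L\<rceil>"
  defines "n \<equiv> nat \<lceil>(4 * real l / \<epsilon> - 1)\<^sup>2\<rceil>"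
  shows "0 < n" "real ((2 * n) ^ l) \<le> 2 powr (4 * L)\<^sup>2"
    "2 - \<epsilon> \<le> 2 * ((1 - 1 / (1 + sqrt n)) ^ l - (1/2) ^ l)"
proof -
  \<comment> \<open>This is where epsilon < 2 matters: with L > 1, additive constants can be
    absorbed into multiples of L.\<close>
  have L1: "1 < L" unfolding L_def using e by (simp add: less_log_iff field_simps)
  have pL: "2 powr L = 4 / \<epsilon>" unfolding L_def using e by simp
  have l_ge: "L \<le> real l" and l_le: "real l \<le> L + 1" using L1 by (simp_all add: l_def)
  have l1: "1 < real l" using L1 l_ge by simp
  define m where "m = 4 * real l / \<epsilon>"
  have m1: "1 < m"
  proof -
    have "2 < 4 / \<epsilon>" using e by (simp add: field_simps)
    then have "2 * 1 < (4 / \<epsilon>) * real l" using l1 e by (intro mult_strict_mono) auto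
    then show ?thesis by (simp add: m_def mult.commute)
  qed
  have n_ge: "(m - 1)\<^sup>2 \<le> real n" unfolding n_def m_def[symmetric] by linarith
  have n_le: "real n \<le> (m - 1)\<^sup>2 + 1" unfolding n_def m_def[symmetric]
    using ceiling_correct[of "(m - 1)\<^sup>2"] by (simp add: of_nat_nat)
  show n0: "0 < n"
  proof -
    have "0 < (m - 1)\<^sup>2" using m1 by simp
    then show ?thesis using n_ge by (metis less_le_trans of_nat_0_less_iff)
  qed
  \<comment> \<open>The ceiling costs at most one, and (m - 1)^2 + 1 <= m^2 because m >= 1.\<close>
  have n_le': "real n \<le> m\<^sup>2" using n_le m1 by (simp add: power2_eq_square algebra_simps)
  show "real ((2 * n) ^ l) \<le> 2 powr (4 * L)\<^sup>2"
  proof -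
    \<comment> \<open>Since m = l 2^L, the crude bound l <= 2^l already keeps m, and with it n,
      within a power of two whose exponent is linear in L.\<close>
    have "real l \<le> 2 ^ l" by (rule less_imp_le[OF of_nat_less_two_power])
    also have "(2::real) ^ l = 2 powr (real l)" by (simp add: powr_realpow)
    also have "\<dots> \<le> 2 powr (L + 1)" using l_le by simp
    finally have "m \<le> 2 powr (L + 1) * 2 powr L"
      unfolding m_def pL using e by (simp add: field_simps)
    also have "\<dots> = 2 powr (2 * L + 1)" by (simp add: powr_add[symmetric])
    finally have "m\<^sup>2 \<le> (2 powr (2 * L + 1))\<^sup>2" using m1 by (intro power_mono) auto
    also have "\<dots> = 2 powr (4 * L + 2)" by (simp add: power2_eq_square powr_add[symmetric])
    finally have "2 * real n \<le> 2 powr 1 * 2 powr (4 * L + 2)" using n_le' by simp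
    also have "\<dots> = 2 powr (4 * L + 3)" by (simp only: powr_add[symmetric]) (simp add: add.commute)
    also have "\<dots> \<le> 2 powr (7 * L)" using L1 by (intro powr_mono) auto
    finally have "(2 * real n) ^ l \<le> (2 powr (7 * L)) ^ l" by (intro power_mono) auto
    also have "\<dots> = 2 powr (7 * L * l)" by (simp add: powr_powr[symmetric] powr_realpow)
    also have "\<dots> \<le> 2 powr (4 * L)\<^sup>2"
    proof (intro powr_mono)
      \<comment> \<open>With l <= L + 1 <= 2 L the exponent is at most 14 L^2; the constant 4 stands
        inside the square, so 16 L^2 is available.\<close>
      have "7 * L * real l \<le> 7 * L * (2 * L)" using L1 l_le by (intro mult_left_mono) auto
      also have "\<dots> \<le> (4 * L)\<^sup>2" using L1 by (simp add: power2_eq_square)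
      finally show "7 * L * real l \<le> (4 * L)\<^sup>2" .
    qed simp
    finally show ?thesis by simp
  qed
  show "2 - \<epsilon> \<le> 2 * ((1 - 1 / (1 + sqrt n)) ^ l - (1/2) ^ l)"
  proof -
    have "m - 1 \<le> sqrt n" using n_ge m1 by (intro real_le_rsqrt) auto
    then have "m \<le> 1 + sqrt n" by simp
    then have "1 / (1 + sqrt n) \<le> 1 / m" using m1 by (intro divide_left_mono) auto
    then have "real l * (1 / (1 + sqrt n)) \<le> real l * (1 / m)" by (intro mult_left_mono) auto
    also have "\<dots> = \<epsilon> / 4" using l1 e by (simp add: m_def)
    finally have lp: "real l * (1 / (1 + sqrt n)) \<le> \<epsilon> / 4" .
    have "1 / (1 + sqrt n) \<le> 1" by (simp add: divide_le_eq_1_pos add_pos_nonneg)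
    then have "1 + real l * (- (1 / (1 + sqrt n))) \<le> (1 + - (1 / (1 + sqrt n))) ^ l"
      by (intro Bernoulli_inequality) simp
    then have "1 - real l * (1 / (1 + sqrt n)) \<le> (1 - 1 / (1 + sqrt n)) ^ l" by simp
    moreover have "(1/2 :: real) ^ l \<le> \<epsilon> / 4"
    proof -
      have "4 / \<epsilon> \<le> 2 powr (real l)" unfolding pL[symmetric] using l_ge by simp
      then have "4 / \<epsilon> \<le> 2 ^ l" by (simp add: powr_realpow)
      then show ?thesis using e by (simp add: power_divide field_simps)
    qed
    ultimately show ?thesis using lp by simp
  qed
qed

theorem theorem2:
  shows "\<exists>C::real. C > 0 \<and>
    (\<forall>\<epsilon>::real. 0 < \<epsilon> \<and> \<epsilon> < 2 \<longrightarrow>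
       (\<exists>(d::nat) \<rho>'. real d \<le> 2 powr (C * (log 2 (4 / \<epsilon>)))\<^sup>2 \<and>
            is_PPT d d \<rho>' \<and> dist_SEP d d \<rho>' \<ge> 2 - \<epsilon>) \<and>
       (let l = nat \<lceil>log 2 (4 / \<epsilon>)\<rceil>;
            ds = nat \<lceil>(4 * real l / \<epsilon> - 1)\<^sup>2\<rceil>;
            d = (2 * ds) ^ l
        in real d \<le> 2 powr (C * (log 2 (4 / \<epsilon>)))\<^sup>2 \<and>
           (\<forall>U. flat_unitary ds U \<longrightarrow>
              (let \<rho>' = bip_tensor_pow (2 * ds) l (rho_bip ds U)
               in is_PPT d d \<rho>' \<and> dist_SEP d d \<rho>' \<ge> 2 - \<epsilon>))))"
proof (rule exI[of _ "4::real"], intro conjI allI impI)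
  fix \<epsilon> :: real assume e: "0 < \<epsilon> \<and> \<epsilon> < 2"
  define l where "l = nat \<lceil>log 2 (4 / \<epsilon>)\<rceil>"
  define n where "n = nat \<lceil>(4 * real l / \<epsilon> - 1)\<^sup>2\<rceil>"
  have b: "0 < n" "real ((2 * n) ^ l) \<le> 2 powr (4 * log 2 (4 / \<epsilon>))\<^sup>2"
    "2 - \<epsilon> \<le> 2 * ((1 - 1 / (1 + sqrt n)) ^ l - (1/2) ^ l)"
    using parameter_bounds[of \<epsilon>] e unfolding n_def l_def by blast+
  have main: "is_PPT ((2*n)^l) ((2*n)^l) (bip_tensor_pow (2*n) l (rho_bip n U)) \<and>
      2 - \<epsilon> \<le> dist_SEP ((2*n)^l) ((2*n)^l) (bip_tensor_pow (2*n) l (rho_bip n U))"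
    if "flat_unitary n U" for U
    using is_PPT_rho_tensor[OF that b(1)] order_trans[OF b(3) dist_SEP_rho_tensor[OF that b(1)]] by blast
  show "\<exists>(d::nat) \<rho>'. real d \<le> 2 powr (4 * log 2 (4 / \<epsilon>))\<^sup>2 \<and> is_PPT d d \<rho>' \<and> dist_SEP d d \<rho>' \<ge> 2 - \<epsilon>"
    \<comment> \<open>The bare existence claim is the explicit construction applied to some flat
      unitary.\<close>
    using flat_unitary_exists[OF b(1)] b(2) main by blast
  show "let l = nat \<lceil>log 2 (4 / \<epsilon>)\<rceil>; ds = nat \<lceil>(4 * real l / \<epsilon> - 1)\<^sup>2\<rceil>; d = (2 * ds) ^ l
        in real d \<le> 2 powr (4 * log 2 (4 / \<epsilon>))\<^sup>2 \<and>
           (\<forall>U. flat_unitary ds U \<longrightarrow>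
              (let \<rho>' = bip_tensor_pow (2 * ds) l (rho_bip ds U)
               in is_PPT d d \<rho>' \<and> dist_SEP d d \<rho>' \<ge> 2 - \<epsilon>))"
    unfolding Let_def l_def[symmetric] n_def[symmetric] using b(2) main by blast
qed simp

end
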